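(* Let $\Phi:\mathbb{R}\to\mathbb{R}$ be a symmetric (even) convex function of class $\mathcal{C}^2$ for which there exist $M>0$ and $0<\varepsilon\leq 1/2$ such that $\Phi(M)>0$ and $$\forall x\geq M,\quad (1+\varepsilon)\Phi(x)\leq x\Phi'(x)\leq (2-\varepsilon)\Phi(x).$$ Let $\mu_\Phi(dx)=\frac{1}{Z_\Phi}e^{-\Phi(x)}dx$ with $Z_\Phi=\int_{\mathbb{R}} e^{-\Phi(x)}dx$. Then there exist constants $A,A',B,D,\kappa\geq 0$ such that for every smooth function $f\geq 0$ on $\mathbb{R}$ satisfying $\int f^2\,d\mu_\Phi=1$, $$\mathbf{Ent}_{\mu_\Phi}(f^2)\leq A\,\mathbf{Var}_{\mu_\Phi}(f)+A'\int_{\{f^2\geq \kappa\}}H_\Phi\left(\frac{f'}{f}\right)f^2\,d\mu_\Phi,$$ where $$H_\Phi(x)=\begin{cases}\Phi^*(Bx)&\text{if }|x|>D,\\ x^2&\text{if }|x|\leq D.\end{cases}$$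
   Context: $\Phi^*(x)=\sup_{y\in\mathbb{R}}\{xy-\Phi(y)\}$ is the Legendre–Fenchel transform of $\Phi$. For a probability measure $\mu$, $\mathbf{Ent}_\mu(f^2)=\int f^2\log f^2\,d\mu-\int f^2\,d\mu\,\log\int f^2\,d\mu$ and $\mathbf{Var}_\mu(f)=\int f^2\,d\mu-\left(\int f\,d\mu\right)^2$. "Smooth function" means a locally absolutely continuous function on $\mathbb{R}$. The convention $0\cdot\infty=0$ is used. The growth hypothesis on $\Phi$ ensures $Z_\Phi<\infty$. *)

theory Defs
  imports "HOL-Probability.Probability"
begin

definition even_fun :: "(real \<Rightarrow> real) \<Rightarrow> bool" where
  "even_fun \<Phi> \<longleftrightarrow> (\<forall>x. \<Phi> (- x) = \<Phi> x)"

definition class_C2 :: "(real \<Rightarrow> real) \<Rightarrow> bool" where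
  "class_C2 \<Phi> \<longleftrightarrow>
     (\<forall>x. \<Phi> differentiable at x) \<and>
     (\<forall>x. deriv \<Phi> differentiable at x) \<and>
     continuous_on UNIV (deriv (deriv \<Phi>))"

definition abs_continuous_on_interval :: "real \<Rightarrow> real \<Rightarrow> (real \<Rightarrow> real) \<Rightarrow> bool" where
  "abs_continuous_on_interval a b f \<longleftrightarrow>
     (\<forall>e>0. \<exists>d>0. \<forall>(n::nat) u v.
        (\<forall>i<n. a \<le> u i \<and> u i \<le> v i \<and> v i \<le> b) \<longrightarrow>
        (\<forall>i<n. \<forall>j<n. i \<noteq> j \<longrightarrow> {u i<..<v i} \<inter> {u j<..<v j} = {}) \<longrightarrow>
        (\<Sum>i<n. v i - u i) < d \<longrightarrow>
        (\<Sum>i<n. \<bar>f (v i) - f (u i)\<bar>) < e)"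

definition locally_abs_continuous :: "(real \<Rightarrow> real) \<Rightarrow> bool" where
  "locally_abs_continuous f \<longleftrightarrow> (\<forall>a b. a \<le> b \<longrightarrow> abs_continuous_on_interval a b f)"

text \<open>The integral of an extended-real-valued function, as positive part minus negative part.
  It is meaningful when at most one of the two parts is infinite (in type \<^typ>\<open>ereal\<close>
  one has \<^term>\<open>\<infinity> - \<infinity> = (\<infinity> :: ereal)\<close>).\<close>

definition ext_integral :: "'a measure \<Rightarrow> ('a \<Rightarrow> ereal) \<Rightarrow> ereal" where
  "ext_integral M h =
     enn2ereal (\<integral>\<^sup>+ x. e2ennreal (h x) \<partial>M) - enn2ereal (\<integral>\<^sup>+ x. e2ennreal (- h x) \<partial>M)"

text \<open>Entropy of a nonnegative integrable function \<open>g\<close> under a probability measure. It may be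
  \<open>+\<infinity>\<close>; the negative part of \<open>g log g\<close> is bounded by \<open>1/e\<close>. At zeros of \<open>g\<close>,
  \<^term>\<open>g x * ln (g x)\<close> is \<open>0\<close>, as usual.\<close>

definition Ent :: "'a measure \<Rightarrow> ('a \<Rightarrow> real) \<Rightarrow> ereal" where
  "Ent M g = ext_integral M (\<lambda>x. ereal (g x * ln (g x)))
               - ereal ((\<integral>x. g x \<partial>M) * ln (\<integral>x. g x \<partial>M))"

definition Var :: "'a measure \<Rightarrow> ('a \<Rightarrow> real) \<Rightarrow> real" where
  "Var M f = (\<integral>x. (f x)\<^sup>2 \<partial>M) - (\<integral>x. f x \<partial>M)\<^sup>2"

definition Z_const :: "(real \<Rightarrow> real) \<Rightarrow> real" where
  "Z_const \<Phi> = (\<integral>x. exp (- \<Phi> x) \<partial>lborel)"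

definition mu :: "(real \<Rightarrow> real) \<Rightarrow> real measure" where
  "mu \<Phi> = density lborel (\<lambda>x. ennreal (exp (- \<Phi> x) / Z_const \<Phi>))"

definition legendre_fenchel :: "(real \<Rightarrow> real) \<Rightarrow> real \<Rightarrow> ereal" where
  "legendre_fenchel \<Phi> x = (SUP y. ereal (x * y - \<Phi> y))"

definition H_fun :: "(real \<Rightarrow> real) \<Rightarrow> real \<Rightarrow> real \<Rightarrow> real \<Rightarrow> ereal" where
  "H_fun \<Phi> B D x = (if \<bar>x\<bar> > D then legendre_fenchel \<Phi> (B * x) else ereal (x\<^sup>2))"

text \<open>The integral of \<open>H (f'/f) f\<^sup>2\<close> over \<open>{f\<^sup>2 \<ge> \<kappa>}\<close>. The derivative of a locally absolutely
  continuous \<open>f\<close> exists almost everywhere; the unspecified value of \<^const>\<open>deriv\<close> on the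
  exceptional null set is immaterial. Where \<open>f\<close> vanishes the integrand is \<open>0\<close>
  (\<open>0 \<cdot> \<infinity> = 0\<close> in type \<^typ>\<open>ereal\<close>). As \<^term>\<open>legendre_fenchel \<Phi> x \<ge> ereal (- \<Phi> 0)\<close>,
  the negative part is integrable whenever \<open>f\<^sup>2\<close> is.\<close>

definition H_energy ::
  "(real \<Rightarrow> real) \<Rightarrow> real \<Rightarrow> real \<Rightarrow> real \<Rightarrow> (real \<Rightarrow> real) \<Rightarrow> ereal" where
  "H_energy \<Phi> B D \<kappa> f =
     ext_integral (mu \<Phi>)
       (\<lambda>x. H_fun \<Phi> B D (deriv f x / f x) * ereal ((f x)\<^sup>2) * indicator {x. (f x)\<^sup>2 \<ge> \<kappa>} x)"

end

theory Submission
  imports Defs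
begin

text \<open>
  Put \<open>s = f'/f\<close> and \<open>\<Psi> = \<Phi> - \<Phi> 0 \<ge> 0\<close>. Where \<open>f\<close> is at most \<open>4\<close>, the integrand \<open>f\<^sup>2 ln f\<^sup>2\<close>
  exceeds \<open>f\<^sup>2 - 1\<close> by at most \<open>9 (f - 1)\<^sup>2\<close> (lemma \<open>square_ln_le\<close>), and \<open>\<integral>(f - 1)\<^sup>2 = 2 - 2 \<integral>f\<close> is at
  most twice the variance. So only the large values of \<open>f\<close> matter, and they have to be paid for by
  the integral \<open>Q\<close> of \<open>f\<^sup>2 (1 + H s) exp (- \<Phi>)\<close> over \<open>{f \<ge> 2}\<close>. The part of \<open>Q\<close> without \<open>H\<close> is again
  controlled by the variance, because \<open>f\<^sup>2 \<le> 4 (f - 1)\<^sup>2\<close> there.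
  Let \<open>G\<close> be a continuously differentiable truncation of \<open>f\<^sup>2\<close> that vanishes where \<open>f \<le> 2\<close> and is comparable to
  \<open>f\<^sup>2\<close> where \<open>f \<ge> 4\<close>.

  Two integrations by parts give all that is needed. Integrating the derivative of
  \<open>y G(y) exp (- \<Phi> y)\<close> over a symmetric interval produces \<open>\<integral>G y \<Phi>' exp (- \<Phi>)\<close>, which dominates
  \<open>(1 + \<epsilon>) \<integral>G \<Psi> exp (- \<Phi>)\<close> up to lower order terms by the lower growth hypothesis. The term that
  contains \<open>f'\<close> is bounded with Young's inequality for \<open>\<Phi>\<close> and its conjugate by
  \<open>H s\<close> and one copy of \<open>G \<Psi>\<close>; after subtracting that copy a fraction \<open>\<epsilon>\<close> is left, so that
  \<open>\<integral>G \<Psi> exp (- \<Phi>) \<le> const Q\<close> (lemma \<open>potential_energy_bound\<close>). This is where superlinear growth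
  of \<open>\<Phi>\<close> enters. The same computation with the weight \<open>x + 1 - y\<close> on \<open>[x, x + 1]\<close>, together with
  \<open>\<bar>\<Phi>'\<bar> \<le> const (1 + \<Psi>)\<close>, bounds the supremum of \<open>G exp (- \<Phi>)\<close> by a multiple of \<open>Q\<close>
  (lemma \<open>weighted_sup_bound\<close>). Finally \<open>ln f\<^sup>2 \<le> f\<^sup>2 exp (- \<Psi>) + \<Psi>\<close>, so where \<open>f \<ge> 4\<close> the
  integrand \<open>f\<^sup>2 ln f\<^sup>2\<close> is at most a multiple of \<open>G (G exp (- \<Phi>)) + G \<Psi>\<close>, and the two
  bounds finish the proof (lemma \<open>truncated_entropy_bound\<close>).

  The integrations by parts are applied to an absolutely continuous \<open>f\<close>. They rest on two facts
  proved first: such a function is differentiable almost everywhere, because it is a difference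
  of continuous monotone functions, for which Vitali's covering theorem shows that the Dini
  derivatives agree; and it is the integral of its derivative, which the gauge integral gives
  directly. The constants obtained are \<open>D = 1\<close> and \<open>\<kappa> = 4\<close>, with a large \<open>B\<close>.
\<close>

section \<open>Bounded variation of absolutely continuous functions\<close>

text \<open>A partition of \<open>[a, b]\<close> is encoded as the first \<open>n + 1\<close> values of a monotone sequence, with repetitions
  allowed. Truncating the sequence with \<open>min\<close> or \<open>max\<close> then splits a partition at a point without
  any case distinction on where the point lies.\<close>

definition var_sums :: "(real \<Rightarrow> real) \<Rightarrow> real \<Rightarrow> real \<Rightarrow> real set" where
  "var_sums f a b =
     {\<Sum>i<n. \<bar>f (t (Suc i)) - f (t i)\<bar> | (n::nat) t. mono t \<and> t 0 = a \<and> t n = b}"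

definition variation :: "(real \<Rightarrow> real) \<Rightarrow> real \<Rightarrow> real \<Rightarrow> real" where
  "variation f a x = Sup (var_sums f a x)"

lemma var_sums_append:
  assumes "s \<in> var_sums f a x" "x \<le> y"
  shows "s + \<bar>f y - f x\<bar> \<in> var_sums f a y"
proof -
  obtain n t where t: "mono t" "t 0 = a" "t n = x"
    and s: "s = (\<Sum>i<n. \<bar>f (t (Suc i)) - f (t i)\<bar>)"
    using assms(1) by (auto simp: var_sums_def)
  define t' where "t' = (\<lambda>i. if i \<le> n then t i else y)"
  have "mono t'"
    unfolding mono_def t'_def using monoD[OF t(1)] t(3) assms(2) by (auto intro: order_trans)
  moreover have "t' 0 = a" "t' (Suc n) = y"
    using t by (auto simp: t'_def)
  moreover have "(\<Sum>i<Suc n. \<bar>f (t' (Suc i)) - f (t' i)\<bar>) = s + \<bar>f y - f x\<bar>"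
    using t(3) by (auto simp: t'_def s intro!: sum.cong)
  ultimately show ?thesis
    unfolding var_sums_def by (auto intro!: exI[of _ "Suc n"] exI[of _ t'])
qed

lemma var_sums_trivial: "0 \<in> var_sums f a a"
  unfolding var_sums_def by (auto intro!: exI[of _ "0::nat"] exI[of _ "\<lambda>_. a"] simp: mono_def)

lemma var_sums_nonempty: "a \<le> x \<Longrightarrow> var_sums f a x \<noteq> {}"
  using var_sums_append[OF var_sums_trivial] by fast

lemma var_sums_split:
  assumes "s \<in> var_sums f a y" "a \<le> x" "x \<le> y"
  obtains s1 s2 where "s1 \<in> var_sums f a x" "s2 \<in> var_sums f x y" "s \<le> s1 + s2"
proof -
  obtain n t where t: "mono t" "t 0 = a" "t n = y"
    and s: "s = (\<Sum>i<n. \<bar>f (t (Suc i)) - f (t i)\<bar>)"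
    using assms(1) by (auto simp: var_sums_def)
  define l where "l = (\<lambda>i. min (t i) x)"
  define r where "r = (\<lambda>i. max (t i) x)"
  have "mono l" "mono r"
    unfolding l_def r_def by (intro monoI min.mono max.mono monoD[OF t(1)] order_refl; assumption)+
  moreover have "l 0 = a" "l n = x" "r 0 = x" "r n = y"
    using t assms by (auto simp: l_def r_def)
  ultimately have "(\<Sum>i<n. \<bar>f (l (Suc i)) - f (l i)\<bar>) \<in> var_sums f a x"
    "(\<Sum>i<n. \<bar>f (r (Suc i)) - f (r i)\<bar>) \<in> var_sums f x y"
    unfolding var_sums_def by blast+
  \<comment> \<open>if the cut lies inside the step this is the triangle inequality, otherwise one summand vanishes\<close>
  moreover have "\<bar>f (t (Suc i)) - f (t i)\<bar>
      \<le> \<bar>f (l (Suc i)) - f (l i)\<bar> + \<bar>f (r (Suc i)) - f (r i)\<bar>" for i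
    using monoD[OF t(1), of i "Suc i"] unfolding l_def r_def by (auto simp: min_def max_def)
  then have "s \<le> (\<Sum>i<n. \<bar>f (l (Suc i)) - f (l i)\<bar>) + (\<Sum>i<n. \<bar>f (r (Suc i)) - f (r i)\<bar>)"
    unfolding s sum.distrib[symmetric] by (intro sum_mono)
  ultimately show ?thesis using that by blast
qed

text \<open>The intervals of a partition of a short interval are a disjoint family of small total length,
  so absolute continuity bounds the whole variation there and not just the increment.\<close>

lemma abs_continuous_var_sums_small:
  assumes "abs_continuous_on_interval a b f" "e > 0"
  obtains d where "d > 0"
    "\<And>x y s. a \<le> x \<Longrightarrow> y \<le> b \<Longrightarrow> y - x < d \<Longrightarrow> s \<in> var_sums f x y \<Longrightarrow> s < e"
proof -
  obtain d where d: "d > 0" and small: "\<forall>(n::nat) u v.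
        (\<forall>i<n. a \<le> u i \<and> u i \<le> v i \<and> v i \<le> b) \<longrightarrow>
        (\<forall>i<n. \<forall>j<n. i \<noteq> j \<longrightarrow> {u i<..<v i} \<inter> {u j<..<v j} = {}) \<longrightarrow>
        (\<Sum>i<n. v i - u i) < d \<longrightarrow> (\<Sum>i<n. \<bar>f (v i) - f (u i)\<bar>) < e"
    using assms(1)[unfolded abs_continuous_on_interval_def, rule_format, OF assms(2)] by blast
  have "s < e" if xy: "a \<le> x" "y \<le> b" "y - x < d" and sv: "s \<in> var_sums f x y" for x y s
  proof -
    obtain n t where t: "mono t" "t 0 = x" "t n = y"
      and s: "s = (\<Sum>i<n. \<bar>f (t (Suc i)) - f (t i)\<bar>)"
      using sv by (auto simp: var_sums_def)
    have "{t i<..<t (Suc i)} \<inter> {t j<..<t (Suc j)} = {}" if "i \<noteq> j" for i j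
    proof -
      have "Suc i \<le> j \<or> Suc j \<le> i" using that by linarith
      then show ?thesis using monoD[OF t(1), of "Suc i" j] monoD[OF t(1), of "Suc j" i] by auto
    qed
    moreover have "a \<le> t i \<and> t i \<le> t (Suc i) \<and> t (Suc i) \<le> b" if "i < n" for i
      using monoD[OF t(1), of 0 i] monoD[OF t(1), of i "Suc i"] monoD[OF t(1), of "Suc i" n] t xy that
      by simp
    moreover have "(\<Sum>i<n. t (Suc i) - t i) < d"
      using sum_lessThan_telescope[of t n] t xy by simp
    ultimately show ?thesis unfolding s by (intro small[rule_format]) auto
  qed
  then show ?thesis using that d by blast
qed

text \<open>On each piece of length \<open>d/2\<close> the variation is less than \<open>1\<close>, so the variation grows at most
  linearly with the number of pieces.\<close>

lemma abs_continuous_bdd_var_sums: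
  assumes "abs_continuous_on_interval a b f" "x \<le> b"
  shows "bdd_above (var_sums f a x)"
proof -
  obtain d where d: "d > 0"
    "\<And>x y s. a \<le> x \<Longrightarrow> y \<le> b \<Longrightarrow> y - x < d \<Longrightarrow> s \<in> var_sums f x y \<Longrightarrow> s < 1"
    using abs_continuous_var_sums_small[OF assms(1), of 1] by (metis zero_less_one)
  have *: "s \<le> real n + 1"
    if "x \<le> b" "x \<le> a + real n * (d/2)" "s \<in> var_sums f a x" for n x s
    using that
  proof (induction n arbitrary: x s)
    case 0
    then show ?case using d(2)[of a x s] d(1) by fastforce
  next
    case (Suc n)
    show ?case
    proof (cases "x \<le> a + real n * (d/2)")
      case True
      then show ?thesis using Suc by fastforce
    next
      case False
      let ?z = "a + real n * (d/2)"
      have "a \<le> ?z" using d by simp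
      then obtain s1 s2 where s: "s1 \<in> var_sums f a ?z" "s2 \<in> var_sums f ?z x" "s \<le> s1 + s2"
        using var_sums_split[OF Suc.prems(3), of ?z] False by auto
      have "s1 \<le> real n + 1" using Suc.IH[of ?z s1] s False Suc.prems by auto
      moreover have "s2 < 1"
        using d(2)[of ?z x s2] s \<open>a \<le> ?z\<close> Suc.prems d(1) by (auto simp: field_simps)
      ultimately show ?thesis using s by simp
    qed
  qed
  obtain n :: nat where "(x - a) / (d/2) \<le> real n" using real_arch_simple by blast
  then have "x \<le> a + real n * (d/2)" using d(1) by (simp add: field_simps)
  then show ?thesis using * assms(2) unfolding bdd_above_def by blast
qed

text \<open>Jordan decomposition: \<open>f = V - (V - f)\<close> with \<open>V\<close> the variation of \<open>f\<close> from \<open>a\<close>. Continuity of \<open>V\<close> is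
  kept because it makes the sets of points with prescribed Dini derivatives Borel.\<close>

lemma abs_continuous_diff_mono:
  assumes ac: "abs_continuous_on_interval a b f"
  obtains V where "continuous_on {a..b} V" "continuous_on {a..b} f"
    "\<And>x y. a \<le> x \<Longrightarrow> x \<le> y \<Longrightarrow> y \<le> b \<Longrightarrow> V x \<le> V y"
    "\<And>x y. a \<le> x \<Longrightarrow> x \<le> y \<Longrightarrow> y \<le> b \<Longrightarrow> V x - f x \<le> V y - f y"
proof -
  define V where "V = variation f a"
  have inc: "V x + \<bar>f y - f x\<bar> \<le> V y" if "a \<le> x" "x \<le> y" "y \<le> b" for x y
  proof -
    have "V x \<le> V y - \<bar>f y - f x\<bar>"
      unfolding V_def variation_def
    proof (rule cSup_least)
      show "var_sums f a x \<noteq> {}" using that var_sums_nonempty by blast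
      fix s assume "s \<in> var_sums f a x"
      from cSup_upper[OF var_sums_append[OF this that(2)] abs_continuous_bdd_var_sums[OF ac that(3)]]
      show "s \<le> Sup (var_sums f a y) - \<bar>f y - f x\<bar>" by simp
    qed
    then show ?thesis by simp
  qed
  have close: "\<exists>d>0. \<forall>x y. a \<le> x \<and> x \<le> y \<and> y \<le> b \<and> y - x < d \<longrightarrow> V y \<le> V x + e" if "e > 0" for e
  proof -
    obtain d where d: "d > 0"
      "\<And>x y s. a \<le> x \<Longrightarrow> y \<le> b \<Longrightarrow> y - x < d \<Longrightarrow> s \<in> var_sums f x y \<Longrightarrow> s < e"
      using abs_continuous_var_sums_small[OF ac \<open>e > 0\<close>] by metis
    have "V y \<le> V x + e" if xy: "a \<le> x" "x \<le> y" "y \<le> b" "y - x < d" for x y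
      unfolding V_def variation_def
    proof (rule cSup_least)
      show "var_sums f a y \<noteq> {}" using that var_sums_nonempty[of a y] by simp
      fix s assume "s \<in> var_sums f a y"
      then obtain s1 s2 where s: "s1 \<in> var_sums f a x" "s2 \<in> var_sums f x y" "s \<le> s1 + s2"
        using var_sums_split xy by metis
      have "s1 \<le> Sup (var_sums f a x)"
        using cSup_upper[OF s(1) abs_continuous_bdd_var_sums[OF ac]] xy by auto
      then show "s \<le> Sup (var_sums f a x) + e" using d(2)[of x y s2] s xy by fastforce
    qed
    then show ?thesis using d(1) by blast
  qed
  have cont: "continuous_on {a..b} g"
    if g: "\<And>x y. a \<le> x \<Longrightarrow> x \<le> y \<Longrightarrow> y \<le> b \<Longrightarrow> \<bar>g y - g x\<bar> \<le> V y - V x" for g :: "real \<Rightarrow> real"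
    unfolding continuous_on_iff
  proof (intro ballI allI impI)
    fix x e :: real assume x: "x \<in> {a..b}" "e > 0"
    obtain d where d: "d > 0" "\<forall>x y. a \<le> x \<and> x \<le> y \<and> y \<le> b \<and> y - x < d \<longrightarrow> V y \<le> V x + e/2"
      using close[of "e/2"] x by auto
    have "dist (g y) (g x) < e" if "y \<in> {a..b}" "dist y x < d" for y
    proof (cases "x \<le> y")
      case True
      then have "V y \<le> V x + e/2" using d(2) x that by (auto simp: dist_real_def)
      then show ?thesis using g[of x y] True that x unfolding dist_real_def by auto
    next
      case False
      then have "V x \<le> V y + e/2" using d(2) x that by (auto simp: dist_real_def)
      then show ?thesis using g[of y x] False that x unfolding dist_real_def by auto
    qed
    then show "\<exists>d>0. \<forall>x'\<in>{a..b}. dist x' x < d \<longrightarrow> dist (g x') (g x) < e" using d(1) by blast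
  qed
  show ?thesis
  proof (rule that)
    show "continuous_on {a..b} V" "continuous_on {a..b} f"
      using inc by (intro cont; smt (verit))+
    show "V x \<le> V y" "V x - f x \<le> V y - f y" if "a \<le> x" "x \<le> y" "y \<le> b" for x y
      using inc[OF that] by linarith+
  qed
qed

section \<open>Differentiability almost everywhere\<close>

text \<open>Vitali's theorem in a form suited to difference quotients: the intervals have to contain the
  point, possibly as an endpoint, and carry an additional property \<open>P\<close>. Dropping the countably many
  endpoints of the selected intervals costs a null set, which later allows the selection to be
  repeated inside the open intervals.\<close>

lemma vitali_intervals:
  assumes U: "open U" "E \<subseteq> U"
    and small: "\<And>x d. x \<in> E \<Longrightarrow> d > 0 \<Longrightarrow> \<exists>u v. u \<le> x \<and> x \<le> v \<and> u < v \<and> v - u < d \<and> P u v"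
  obtains C :: "(real \<times> real) set" where "countable C"
    "\<And>u v. (u, v) \<in> C \<Longrightarrow> u < v \<and> {u..v} \<subseteq> U \<and> P u v"
    "disjoint_family_on (\<lambda>(u, v). {u..v}) C"
    "E - (\<Union>(u, v)\<in>C. {u<..<v}) \<in> null_sets lebesgue"
proof -
  define K where "K = {(u, v). u < v \<and> {u..v} \<subseteq> U \<and> P u v}"
  let ?a = "\<lambda>(u, v). (u + v) / 2 :: real"
  let ?r = "\<lambda>(u, v). (v - u) / 2 :: real"
  have ball: "cball (?a i) (?r i) = (\<lambda>(u, v). {u..v}) i" for i
    by (cases i) (auto simp: cball_eq_atLeastAtMost field_simps)
  have r: "0 < ?r i" if "i \<in> K" for i
    using that by (auto simp: K_def)
  have S: "\<exists>i. i \<in> K \<and> x \<in> cball (?a i) (?r i) \<and> ?r i < d" if x: "x \<in> E" "d > 0" for x d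
  proof -
    obtain e where e: "e > 0" "ball x e \<subseteq> U" using U x open_contains_ball by blast
    obtain u v where uv: "u \<le> x" "x \<le> v" "u < v" "v - u < min d e" "P u v"
      using small[OF x(1), of "min d e"] x e by auto
    have "{u..v} \<subseteq> ball x e" using uv by (auto simp: dist_real_def)
    then have "(u, v) \<in> K" using uv e by (auto simp: K_def)
    moreover have "x \<in> cball (?a (u, v)) (?r (u, v))" using uv unfolding ball by auto
    moreover have "?r (u, v) < d" using uv by auto
    ultimately show ?thesis by blast
  qed
  obtain C where C: "countable C" "C \<subseteq> K"
     "pairwise (\<lambda>i j. disjnt (cball (?a i) (?r i)) (cball (?a j) (?r j))) C"
     "negligible (E - (\<Union>i \<in> C. cball (?a i) (?r i)))"
    using Vitali_covering_theorem_cballs[of K ?r E ?a] r S by blast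
  have "countable (\<Union>(u, v)\<in>C. {u, v})" using C(1) by (intro countable_UN) auto
  then have "negligible (\<Union>(u, v)\<in>C. {u, v})"
    using countable_imp_null_set_lborel null_sets_completionI negligible_iff_null_sets by blast
  with C(4) have "negligible ((E - (\<Union>i \<in> C. cball (?a i) (?r i))) \<union> (\<Union>(u, v)\<in>C. {u, v}))"
    by (rule negligible_Un)
  then have "negligible (E - (\<Union>(u, v)\<in>C. {u<..<v}))"
    by (rule negligible_subset) (auto simp: ball, force)
  then have null: "E - (\<Union>(u, v)\<in>C. {u<..<v}) \<in> null_sets lebesgue"
    by (simp add: negligible_iff_null_sets)
  show ?thesis
  proof (rule that[OF C(1) _ _ null])
    show "u < v \<and> {u..v} \<subseteq> U \<and> P u v" if "(u, v) \<in> C" for u v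
      using that C(2) by (auto simp: K_def)
    show "disjoint_family_on (\<lambda>(u, v). {u..v}) C"
      using C(3) unfolding ball disjoint_family_on_def pairwise_def disjnt_def by blast
  qed
qed

lemma emeasure_le_Vitali_cover:
  fixes C :: "(real \<times> real) set"
  assumes "countable C" "disjoint_family_on (\<lambda>(u, v). {u..v}) C" "E \<in> sets borel"
    and null: "E - (\<Union>(u, v)\<in>C. {u<..<v}) \<in> null_sets lebesgue"
  shows "emeasure lborel E \<le> (\<integral>\<^sup>+ (u, v). emeasure lborel (E \<inter> {u<..<v}) \<partial>count_space C)"
proof -
  let ?I = "\<lambda>(u, v). {u<..<v :: real}"
  let ?W = "\<Union>i\<in>C. ?I i"
  have [measurable]: "?I i \<in> sets borel" for i by (cases i) auto
  have W [measurable]: "?W \<in> sets borel" using assms(1) by (intro sets.countable_UN'') auto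
  have disj: "disjoint_family_on (\<lambda>i. E \<inter> ?I i) C"
    using assms(2) unfolding disjoint_family_on_def by fastforce
  have "emeasure lborel (E - ?W) = 0"
  proof -
    have "E - ?W \<in> sets lborel" using assms(3) W by auto
    then have "E - ?W \<in> null_sets lborel"
      using null null_sets_completion_iff by blast
    then show ?thesis by (rule null_setsD1)
  qed
  have "emeasure lborel E \<le> emeasure lborel ((E \<inter> ?W) \<union> (E - ?W))"
    using assms(3) by (intro emeasure_mono) auto
  also have "\<dots> \<le> emeasure lborel (E \<inter> ?W) + emeasure lborel (E - ?W)"
    using assms(3) by (intro emeasure_subadditive) auto
  also have "\<dots> = emeasure lborel (\<Union>i\<in>C. E \<inter> ?I i)"
    unfolding \<open>emeasure lborel (E - ?W) = 0\<close> Int_UN_distrib by simp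
  also have "\<dots> = (\<integral>\<^sup>+ i. emeasure lborel (E \<inter> ?I i) \<partial>count_space C)"
  proof (rule emeasure_UN_countable)
    show "E \<inter> ?I i \<in> sets lborel" if "i \<in> C" for i
      using assms(3) \<open>?I i \<in> sets borel\<close> by simp
  qed (use assms(1) disj in auto)
  finally show ?thesis by (simp add: split_def)
qed

lemma sum_emeasure_disjoint_intervals_le:
  fixes C :: "(real \<times> real) set"
  assumes "countable C" "disjoint_family_on (\<lambda>(u, v). {u..v}) C"
    "\<And>u v. (u, v) \<in> C \<Longrightarrow> {u..v} \<subseteq> U" "sets M = sets borel" "U \<in> sets borel"
  shows "(\<integral>\<^sup>+ (u, v). emeasure M {u..v} \<partial>count_space C) \<le> emeasure M U"
proof -
  let ?I = "\<lambda>(u, v). {u..v :: real}"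
  have I: "?I i \<in> sets M" for i using assms(4) by (cases i) auto
  have "(\<integral>\<^sup>+ (u, v). emeasure M {u..v} \<partial>count_space C) = (\<integral>\<^sup>+ i. emeasure M (?I i) \<partial>count_space C)"
    by (simp add: split_def)
  also have "\<dots> = emeasure M (\<Union>i\<in>C. ?I i)"
    using assms I by (intro emeasure_UN_countable[symmetric]) auto
  also have "\<dots> \<le> emeasure M U"
    using assms by (intro emeasure_mono) auto
  finally show ?thesis .
qed

text \<open>Cover \<open>E\<close> by disjoint intervals inside \<open>U\<close> on which \<open>\<nu>\<close> has mean density at least \<open>R\<close>, and add up.\<close>

lemma upper_density_bound:
  fixes \<nu> :: "real measure"
  assumes "open U" "E \<subseteq> U" "E \<in> sets borel" "sets \<nu> = sets borel"
    and small: "\<And>x d. x \<in> E \<Longrightarrow> d > 0 \<Longrightarrow>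
      \<exists>u v. u \<le> x \<and> x \<le> v \<and> u < v \<and> v - u < d \<and> ennreal (R * (v - u)) \<le> emeasure \<nu> {u..v}"
    and "R \<ge> 0"
  shows "ennreal R * emeasure lborel E \<le> emeasure \<nu> U"
proof -
  obtain C :: "(real \<times> real) set" where C: "countable C"
    "\<And>u v. (u, v) \<in> C \<Longrightarrow> u < v \<and> {u..v} \<subseteq> U \<and> ennreal (R * (v - u)) \<le> emeasure \<nu> {u..v}"
    "disjoint_family_on (\<lambda>(u, v). {u..v}) C"
    "E - (\<Union>(u, v)\<in>C. {u<..<v}) \<in> null_sets lebesgue"
    by (rule vitali_intervals[OF assms(1,2),
        where P = "\<lambda>u v. ennreal (R * (v - u)) \<le> emeasure \<nu> {u..v}"]) (use small in blast)+
  have "ennreal R * emeasure lborel E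
      \<le> ennreal R * (\<integral>\<^sup>+ (u, v). emeasure lborel (E \<inter> {u<..<v}) \<partial>count_space C)"
    by (intro mult_left_mono emeasure_le_Vitali_cover C assms) auto
  also have "\<dots> = (\<integral>\<^sup>+ (u, v). ennreal R * emeasure lborel (E \<inter> {u<..<v}) \<partial>count_space C)"
    by (subst nn_integral_cmult[symmetric]) (auto simp: split_def)
  also have "\<dots> \<le> (\<integral>\<^sup>+ (u, v). emeasure \<nu> {u..v} \<partial>count_space C)"
  proof (rule nn_integral_mono, clarsimp)
    fix u v assume uv: "(u, v) \<in> C"
    have "emeasure lborel (E \<inter> {u<..<v}) \<le> emeasure lborel {u<..<v}"
      by (intro emeasure_mono) auto
    also have "\<dots> = ennreal (v - u)" using C(2)[OF uv] by simp
    finally have "ennreal R * emeasure lborel (E \<inter> {u<..<v}) \<le> ennreal (R * (v - u))"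
      using assms(6) C(2)[OF uv] by (simp add: ennreal_mult mult_left_mono)
    then show "ennreal R * emeasure lborel (E \<inter> {u<..<v}) \<le> emeasure \<nu> {u..v}"
      using C(2)[OF uv] order_trans by blast
  qed
  also have "\<dots> \<le> emeasure \<nu> U"
    using C assms by (intro sum_emeasure_disjoint_intervals_le) auto
  finally show ?thesis .
qed

text \<open>First cover \<open>E\<close> by disjoint intervals of density at most \<open>r\<close> inside an open set \<open>U\<close>, then apply
  \<open>upper_density_bound\<close> inside each of them. This gives \<open>R \<bar>E\<bar> \<le> r \<bar>U\<bar>\<close>, and \<open>U\<close> may be taken
  arbitrarily close to \<open>E\<close> in measure.\<close>

lemma different_densities_null:
  fixes \<nu> :: "real measure"
  assumes E: "E \<in> sets borel" "bounded E" and \<nu>: "sets \<nu> = sets borel" and rR: "0 \<le> r" "r < R"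
    and upper: "\<And>x d. x \<in> E \<Longrightarrow> d > 0 \<Longrightarrow>
      \<exists>u v. u \<le> x \<and> x \<le> v \<and> u < v \<and> v - u < d \<and> ennreal (R * (v - u)) \<le> emeasure \<nu> {u..v}"
    and lower: "\<And>x d. x \<in> E \<Longrightarrow> d > 0 \<Longrightarrow>
      \<exists>u v. u \<le> x \<and> x \<le> v \<and> u < v \<and> v - u < d \<and> emeasure \<nu> {u..v} \<le> ennreal (r * (v - u))"
  shows "E \<in> null_sets lborel"
proof -
  have fin: "emeasure lborel E < \<infinity>"
    using E emeasure_bounded_finite by blast
  have le: "ennreal R * emeasure lborel E \<le> ennreal r * emeasure lborel U" if U: "open U" "E \<subseteq> U" for U
  proof -
    obtain C :: "(real \<times> real) set" where C: "countable C"
      "\<And>u v. (u, v) \<in> C \<Longrightarrow> u < v \<and> {u..v} \<subseteq> U \<and> emeasure \<nu> {u..v} \<le> ennreal (r * (v - u))"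
      "disjoint_family_on (\<lambda>(u, v). {u..v}) C"
      "E - (\<Union>(u, v)\<in>C. {u<..<v}) \<in> null_sets lebesgue"
      by (rule vitali_intervals[OF U,
        where P = "\<lambda>u v. emeasure \<nu> {u..v} \<le> ennreal (r * (v - u))"]) (use lower in blast)+
    have "ennreal R * emeasure lborel E
        \<le> ennreal R * (\<integral>\<^sup>+ (u, v). emeasure lborel (E \<inter> {u<..<v}) \<partial>count_space C)"
      by (intro mult_left_mono emeasure_le_Vitali_cover C E) auto
    also have "\<dots> = (\<integral>\<^sup>+ (u, v). ennreal R * emeasure lborel (E \<inter> {u<..<v}) \<partial>count_space C)"
      by (subst nn_integral_cmult[symmetric]) (auto simp: split_def)
    also have "\<dots> \<le> (\<integral>\<^sup>+ (u, v). ennreal r * emeasure lborel {u..v} \<partial>count_space C)"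
    proof (rule nn_integral_mono, clarsimp)
      fix u v assume uv: "(u, v) \<in> C"
      have "ennreal R * emeasure lborel (E \<inter> {u<..<v}) \<le> emeasure \<nu> {u<..<v}"
        using E \<nu> rR upper by (intro upper_density_bound) auto
      also have "\<dots> \<le> emeasure \<nu> {u..v}" using \<nu> by (intro emeasure_mono) auto
      also have "\<dots> \<le> ennreal (r * (v - u))" using C(2)[OF uv] by simp
      finally show "ennreal R * emeasure lborel (E \<inter> {u<..<v}) \<le> ennreal r * emeasure lborel {u..v}"
        using C(2)[OF uv] rR by (simp add: ennreal_mult)
    qed
    also have "\<dots> = ennreal r * (\<integral>\<^sup>+ (u, v). emeasure lborel {u..v} \<partial>count_space C)"
      by (subst nn_integral_cmult[symmetric]) (auto simp: split_def)
    also have "\<dots> \<le> ennreal r * emeasure lborel U"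
      using C U by (intro mult_left_mono sum_emeasure_disjoint_intervals_le) auto
    finally show ?thesis .
  qed
  define m where "m = measure lborel E"
  have m: "emeasure lborel E = ennreal m" "m \<ge> 0"
    using fin by (auto simp: m_def emeasure_eq_ennreal_measure)
  have "R * m \<le> r * m + e" if "e > 0" for e
  proof -
    have "0 < e / (r + 1)" using rR(1) that by (intro divide_pos_pos) auto
    obtain U where U: "open U" "E \<subseteq> U" "emeasure lborel (U - E) < ennreal (e / (r + 1))"
      by (rule outer_regular_lborel[OF E(1) \<open>0 < e / (r + 1)\<close>])
    have "emeasure lborel (E \<union> (U - E)) \<le> emeasure lborel E + emeasure lborel (U - E)"
      using E U by (intro emeasure_subadditive) auto
    moreover have "E \<union> (U - E) = U" using U(2) by blast
    ultimately have "emeasure lborel U \<le> ennreal m + emeasure lborel (U - E)"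
      using m by metis
    also have "\<dots> \<le> ennreal m + ennreal (e / (r + 1))"
      by (rule add_left_mono[OF less_imp_le[OF U(3)]])
    finally have U_le: "emeasure lborel U \<le> ennreal m + ennreal (e / (r + 1))" .
    have "ennreal (R * m) = ennreal R * ennreal m" using m rR by (intro ennreal_mult) auto
    also have "\<dots> \<le> ennreal r * emeasure lborel U" using le[OF U(1,2)] m(1) by metis
    also have "\<dots> \<le> ennreal r * (ennreal m + ennreal (e / (r + 1)))"
      by (rule mult_left_mono[OF U_le zero_le])
    also have "\<dots> = ennreal (r * (m + e / (r + 1)))"
      using m rR \<open>0 < e / (r + 1)\<close> by (simp add: ennreal_mult ennreal_plus)
    finally have "R * m \<le> r * (m + e / (r + 1))"
      using m rR \<open>0 < e / (r + 1)\<close> by (simp add: ennreal_le_iff)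
    also have "\<dots> \<le> r * m + e"
    proof -
      have "r * (e / (r + 1)) \<le> e" using rR that by (simp add: field_simps)
      then show ?thesis by (simp add: algebra_simps)
    qed
    finally show ?thesis .
  qed
  then have "R * m \<le> r * m" by (rule field_le_epsilon)
  then have "m = 0" using m rR mult_strict_right_mono[of r R m] by (cases "m = 0") auto
  then show ?thesis using m E by (auto simp: null_sets_def)
qed

lemma frequently_at_0_iff:
  fixes P :: "real \<Rightarrow> bool"
  shows "(\<exists>\<^sub>F h in at 0. P h) \<longleftrightarrow> (\<forall>n::nat. \<exists>h. h \<noteq> 0 \<and> \<bar>h\<bar> < 1 / Suc n \<and> P h)"
proof
  assume "\<exists>\<^sub>F h in at 0. P h"
  then show "\<forall>n::nat. \<exists>h. h \<noteq> 0 \<and> \<bar>h\<bar> < 1 / Suc n \<and> P h"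
    unfolding frequently_def eventually_at by (force simp: dist_real_def)
next
  assume R: "\<forall>n::nat. \<exists>h. h \<noteq> 0 \<and> \<bar>h\<bar> < 1 / Suc n \<and> P h"
  show "\<exists>\<^sub>F h in at 0. P h"
  proof (rule ccontr)
    assume "\<not> ?thesis"
    then obtain d where "d > 0" and *: "\<forall>x. x \<noteq> 0 \<and> \<bar>x\<bar> < d \<longrightarrow> \<not> P x"
      unfolding frequently_def eventually_at by (auto simp: dist_real_def)
    then obtain n :: nat where "1 / Suc n < d" using nat_approx_posE by blast
    then show False using R * by (meson less_trans)
  qed
qed

lemma frequently_at_0_D:
  fixes P :: "real \<Rightarrow> bool"
  assumes "\<exists>\<^sub>F h in at 0. P h" "d > 0"
  shows "\<exists>h. h \<noteq> 0 \<and> \<bar>h\<bar> < d \<and> P h"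
  using assms unfolding frequently_def eventually_at by (auto simp: dist_real_def)

text \<open>If the lower and the upper limit differed, two rationals would separate them.\<close>

lemma limit_if_no_gap:
  fixes q :: "real \<Rightarrow> real"
  assumes nonneg: "eventually (\<lambda>h. 0 \<le> q h) F" and F: "F \<noteq> bot"
    and bdd: "\<exists>m::nat. \<not> (\<exists>\<^sub>F h in F. real m < q h)"
    and no_gap: "\<And>r R. r \<in> \<rat> \<Longrightarrow> R \<in> \<rat> \<Longrightarrow> 0 \<le> r \<Longrightarrow> r < R \<Longrightarrow>
      (\<exists>\<^sub>F h in F. q h < r) \<Longrightarrow> (\<exists>\<^sub>F h in F. R < q h) \<Longrightarrow> False"
  shows "\<exists>l. (q \<longlongrightarrow> l) F"
proof -
  let ?q = "\<lambda>h. ereal (q h)"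
  have L0: "0 \<le> Liminf F ?q"
    using nonneg by (intro Liminf_bounded) (auto elim: eventually_mono)
  obtain m :: nat where "eventually (\<lambda>h. q h \<le> m) F"
    using bdd by (auto simp: frequently_def not_less)
  then have Um: "Limsup F ?q \<le> ereal m"
    by (intro Limsup_bounded) (auto elim: eventually_mono)
  have eq: "Liminf F ?q = Limsup F ?q"
  proof (rule ccontr)
    assume "Liminf F ?q \<noteq> Limsup F ?q"
    then have "Liminf F ?q < Limsup F ?q"
      using Liminf_le_Limsup[OF F] by (metis order_le_less)
    then obtain R where R: "Liminf F ?q < ereal (real_of_rat R)" "ereal (real_of_rat R) < Limsup F ?q"
      using ereal_dense3 by blast
    then obtain r where r: "Liminf F ?q < ereal (real_of_rat r)" "real_of_rat r < real_of_rat R"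
      using ereal_dense3[OF R(1)] by auto
    have "0 \<le> real_of_rat r" using L0 r by (metis ereal_less_eq(5) less_imp_le order_trans)
    moreover have "\<exists>\<^sub>F h in F. q h < real_of_rat r"
    proof (rule ccontr)
      assume "\<not> ?thesis"
      then have "eventually (\<lambda>h. ereal (real_of_rat r) \<le> ?q h) F"
        by (simp add: frequently_def not_less)
      from Liminf_bounded[OF this] show False using r by simp
    qed
    moreover have "\<exists>\<^sub>F h in F. real_of_rat R < q h"
    proof (rule ccontr)
      assume "\<not> ?thesis"
      then have "eventually (\<lambda>h. ?q h \<le> ereal (real_of_rat R)) F"
        by (simp add: frequently_def not_less)
      from Limsup_bounded[OF this] show False using R by simp
    qed
    ultimately show False using no_gap[of "real_of_rat r" "real_of_rat R"] r by auto
  qed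
  obtain l where "Limsup F ?q = ereal l"
    using L0 Um eq by (cases "Limsup F ?q") auto
  then have "(?q \<longlongrightarrow> ereal l) F"
    using eq Liminf_eq_Limsup[OF F, of ?q "ereal l"] by simp
  then show ?thesis by (auto simp: lim_ereal)
qed

text \<open>Lebesgue's theorem on the differentiation of monotone functions. The Stieltjes measure of \<open>F\<close> turns
  increments of \<open>F\<close> into measures of intervals. Points with a gap between the Dini derivatives form a
  null set by \<open>different_densities_null\<close>, and points with an infinite upper derivative form one by
  \<open>upper_density_bound\<close>, since the measure of a bounded set is finite.\<close>

theorem mono_continuous_AE_differentiable:
  fixes F :: "real \<Rightarrow> real"
  assumes F: "mono F" "continuous_on UNIV F"
  shows "AE x in lborel. \<exists>l. (F has_real_derivative l) (at x)"
proof -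
  define q where "q x h = (F (x + h) - F x) / h" for x h
  define L where "L r = {x. \<exists>\<^sub>F h in at 0. q x h < r}" for r
  define U where "U R = {x. \<exists>\<^sub>F h in at 0. R < q x h}" for R
  let ?\<nu> = "interval_measure F"
  have \<nu>: "emeasure ?\<nu> {u..v} = ennreal (F v - F u)" if "u \<le> v" for u v
    using emeasure_interval_measure_Icc[OF that, of F] F by (auto simp: mono_def)
  have q0: "0 \<le> q x h" for x h
    using F(1) by (cases "h \<ge> 0") (auto simp: q_def mono_def divide_nonpos_nonpos)
  have open_lt: "open {x. q x h < r}" "open {x. r < q x h}" if "h \<noteq> 0" for h r
    unfolding q_def using that F(2)
    by (auto intro!: open_Collect_less continuous_intros continuous_on_compose2[OF F(2)])
  have L_borel [measurable]: "L r \<in> sets borel" for r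
  proof -
    have "L r = (\<Inter>n::nat. \<Union>h\<in>{h. h \<noteq> 0 \<and> \<bar>h\<bar> < 1 / Suc n}. {x. q x h < r})"
      unfolding L_def frequently_at_0_iff by auto
    also have "\<dots> \<in> sets borel"
      by (intro sets.countable_INT' image_subsetI borel_open open_UN ballI open_lt) auto
    finally show ?thesis .
  qed
  have U_borel [measurable]: "U r \<in> sets borel" for r
  proof -
    have "U r = (\<Inter>n::nat. \<Union>h\<in>{h. h \<noteq> 0 \<and> \<bar>h\<bar> < 1 / Suc n}. {x. r < q x h})"
      unfolding U_def frequently_at_0_iff by auto
    also have "\<dots> \<in> sets borel"
      by (intro sets.countable_INT' image_subsetI borel_open open_UN ballI open_lt) auto
    finally show ?thesis .
  qed
  have upper: "\<exists>u v. u \<le> x \<and> x \<le> v \<and> u < v \<and> v - u < d \<and> ennreal (R * (v - u)) \<le> emeasure ?\<nu> {u..v}"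
    if x: "x \<in> U R" and d: "d > 0" for x d R
  proof -
    obtain h where h: "h \<noteq> 0" "\<bar>h\<bar> < d" "R < q x h"
      using frequently_at_0_D[OF x[unfolded U_def mem_Collect_eq] d] by blast
    show ?thesis
    proof (cases "h > 0")
      case True
      then have "R * h \<le> F (x + h) - F x"
        using h(3) by (simp add: q_def pos_less_divide_eq mult.commute)
      then show ?thesis using h True
        by (intro exI[of _ x] exI[of _ "x + h"]) (simp add: \<nu> ennreal_leI)
    next
      case False
      then have "h < 0" using h(1) by simp
      then have "R * - h \<le> F x - F (x + h)"
        using h(3) by (simp add: q_def neg_less_divide_eq mult.commute)
      then show ?thesis using h \<open>h < 0\<close>
        by (intro exI[of _ "x + h"] exI[of _ x]) (simp add: \<nu> ennreal_leI)
    qed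
  qed
  have lower: "\<exists>u v. u \<le> x \<and> x \<le> v \<and> u < v \<and> v - u < d \<and> emeasure ?\<nu> {u..v} \<le> ennreal (r * (v - u))"
    if x: "x \<in> L r" and d: "d > 0" for x d r
  proof -
    obtain h where h: "h \<noteq> 0" "\<bar>h\<bar> < d" "q x h < r"
      using frequently_at_0_D[OF x[unfolded L_def mem_Collect_eq] d] by blast
    show ?thesis
    proof (cases "h > 0")
      case True
      then have "F (x + h) - F x \<le> r * h"
        using h(3) by (simp add: q_def pos_divide_less_eq mult.commute)
      then show ?thesis using h True
        by (intro exI[of _ x] exI[of _ "x + h"]) (simp add: \<nu> ennreal_leI)
    next
      case False
      then have "h < 0" using h(1) by simp
      then have "F x - F (x + h) \<le> r * - h"
        using h(3) by (simp add: q_def neg_divide_less_eq mult.commute)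
      then show ?thesis using h \<open>h < 0\<close>
        by (intro exI[of _ "x + h"] exI[of _ x]) (simp add: \<nu> ennreal_leI)
    qed
  qed
  have gap: "L r \<inter> U R \<inter> {-real N<..<real N} \<in> null_sets lborel" if "0 \<le> r" "r < R" for r R N
    using that upper lower
    by (intro different_densities_null[where \<nu> = ?\<nu> and r = r and R = R]) auto
  have unbdd: "(\<Inter>m::nat. U (real m)) \<inter> {-real N<..<real N} \<in> null_sets lborel" (is "?E \<in> _") for N
  proof -
    have [measurable]: "?E \<in> sets borel" by measurable
    have "emeasure lborel ?E \<le> emeasure lborel {-real N..real N}"
      by (intro emeasure_mono) auto
    also have "\<dots> < \<infinity>" by simp
    finally obtain c where c: "emeasure lborel ?E = ennreal c" "c \<ge> 0"
      by (cases "emeasure lborel ?E") auto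
    let ?T = "F (real N) - F (- real N)"
    have T: "?T \<ge> 0" using F(1) by (auto simp: mono_def)
    have "real m * c \<le> ?T" for m :: nat
    proof -
      have "ennreal (real m) * emeasure lborel ?E \<le> emeasure ?\<nu> {-real N<..<real N}"
        using upper by (intro upper_density_bound) auto
      also have "\<dots> \<le> emeasure ?\<nu> {-real N..real N}" by (intro emeasure_mono) auto
      also have "\<dots> = ennreal ?T" by (intro \<nu>) auto
      finally show ?thesis using c T by (simp add: ennreal_mult[symmetric])
    qed
    moreover have "\<exists>m::nat. real m * c > ?T" if "c > 0"
      using reals_Archimedean3[OF that] by blast
    ultimately have "c = 0" using c(2) by (metis not_less order_le_less)
    then show ?thesis using c by (auto simp: null_sets_def)
  qed
  have "AE x in lborel. \<forall>N::nat. x \<notin> (\<Inter>m::nat. U (real m)) \<inter> {-real N<..<real N}"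
    unfolding AE_all_countable using unbdd by (blast intro: AE_not_in)
  moreover have "AE x in lborel. \<forall>N::nat. \<forall>r\<in>\<rat>. \<forall>R\<in>\<rat>. 0 \<le> r \<longrightarrow> r < R \<longrightarrow>
      x \<notin> L r \<inter> U R \<inter> {-real N<..<real N}"
    unfolding AE_all_countable 
    by (intro allI AE_ball_countable' AE_impI countable_rat AE_not_in gap)
  ultimately show ?thesis
  proof eventually_elim
    case (elim x)
    obtain N :: nat where "\<bar>x\<bar> < N" using reals_Archimedean2 by blast
    then have N: "x \<in> {-real N<..<real N}" by auto
    have "\<exists>l. (q x \<longlongrightarrow> l) (at 0)"
    proof (rule limit_if_no_gap)
      show "\<forall>\<^sub>F h in at 0. 0 \<le> q x h" using q0 by simp
      show "\<exists>m::nat. \<not> (\<exists>\<^sub>F h in at 0. real m < q x h)"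
        using elim(1) N by (auto simp: U_def)
      show False if "r \<in> \<rat>" "R \<in> \<rat>" "0 \<le> r" "r < R"
        "\<exists>\<^sub>F h in at 0. q x h < r" "\<exists>\<^sub>F h in at 0. R < q x h" for r R
        using elim(2) that N by (auto simp: U_def L_def)
    qed simp
    then show ?case by (simp add: DERIV_def q_def[abs_def])
  qed
qed

theorem locally_abs_continuous_AE_differentiable:
  assumes "locally_abs_continuous f"
  shows "AE x in lborel. \<exists>l. (f has_real_derivative l) (at x)"
proof -
  have "AE x in lborel. \<forall>N::nat. x \<in> {-real N<..<real N} \<longrightarrow> (\<exists>l. (f has_real_derivative l) (at x))"
    unfolding AE_all_countable
  proof
    fix N :: nat
    let ?a = "-real N" and ?b = "real N"
    have ac: "abs_continuous_on_interval ?a ?b f"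
      using assms by (simp add: locally_abs_continuous_def)
    obtain V where V: "continuous_on {?a..?b} V" "continuous_on {?a..?b} f"
      "\<And>x y. ?a \<le> x \<Longrightarrow> x \<le> y \<Longrightarrow> y \<le> ?b \<Longrightarrow> V x \<le> V y"
      "\<And>x y. ?a \<le> x \<Longrightarrow> x \<le> y \<Longrightarrow> y \<le> ?b \<Longrightarrow> V x - f x \<le> V y - f y"
      using abs_continuous_diff_mono[OF ac] by blast
    \<comment> \<open>clamping extends the two monotone functions to the whole line\<close>
    define c where "c x = max ?a (min ?b x)" for x
    have c: "?a \<le> c x" "c x \<le> ?b" "x \<le> y \<Longrightarrow> c x \<le> c y" for x y
      by (auto simp: c_def)
    have c_cont: "continuous_on UNIV c" unfolding c_def by (intro continuous_intros)
    have diff: "AE x in lborel. \<exists>l. ((\<lambda>x. W (c x)) has_real_derivative l) (at x)"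
      if W: "continuous_on {?a..?b} W" "\<And>x y. ?a \<le> x \<Longrightarrow> x \<le> y \<Longrightarrow> y \<le> ?b \<Longrightarrow> W x \<le> W y" for W
      using c by (intro mono_continuous_AE_differentiable monoI W
          continuous_on_compose2[OF W(1) c_cont]) auto
    have "AE x in lborel. \<exists>l. ((\<lambda>x. V (c x)) has_real_derivative l) (at x)"
      using V by (intro diff)
    moreover have "AE x in lborel. \<exists>l. ((\<lambda>x. V (c x) - f (c x)) has_real_derivative l) (at x)"
      using V diff[of "\<lambda>x. V x - f x"] by (auto intro: continuous_on_diff)
    ultimately show "AE x in lborel. x \<in> {?a<..<?b} \<longrightarrow> (\<exists>l. (f has_real_derivative l) (at x))"
    proof eventually_elim
      case (elim x)
      show ?case
      proof
        assume x: "x \<in> {?a<..<?b}"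
        obtain l1 l2 where "((\<lambda>x. V (c x)) has_real_derivative l1) (at x)"
          "((\<lambda>x. V (c x) - f (c x)) has_real_derivative l2) (at x)"
          using elim by blast
        from DERIV_diff[OF this] have "((\<lambda>x. f (c x)) has_real_derivative l1 - l2) (at x)" by simp
        then have "(f has_real_derivative l1 - l2) (at x)"
          by (rule has_field_derivative_transform_within_open[where S = "{?a<..<?b}"])
            (use x in \<open>auto simp: c_def\<close>)
        then show "\<exists>l. (f has_real_derivative l) (at x)" by blast
      qed
    qed
  qed
  then show ?thesis
  proof eventually_elim
    case (elim x)
    obtain N :: nat where "\<bar>x\<bar> < N" using reals_Archimedean2 by blast
    then show ?case using elim by (auto simp: abs_less_iff minus_less_iff)
  qed
qed

text \<open>A Borel version of the derivative is needed because \<^const>\<open>deriv\<close> takes an unspecified value at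
  points of non-differentiability.\<close>

lemma continuous_borel_derivative:
  assumes "continuous_on UNIV f" "AE x in lborel. \<exists>l. (f has_real_derivative l) (at x)"
  obtains g :: "real \<Rightarrow> real" where "g \<in> borel_measurable borel"
    "AE x in lborel. (f has_real_derivative g x) (at x)"
proof -
  define g where "g x = lim (\<lambda>n::nat. (f (x + 1 / Suc n) - f x) / (1 / Suc n))" for x
  have [measurable]: "f \<in> borel_measurable borel"
    using assms(1) borel_measurable_continuous_onI by blast
  have "g \<in> borel_measurable borel" unfolding g_def by measurable
  moreover have "AE x in lborel. (f has_real_derivative g x) (at x)"
    using assms(2)
  proof eventually_elim
    case (elim x)
    then obtain l where l: "(f has_real_derivative l) (at x)" by blast
    have "filterlim (\<lambda>n. 1 / real (Suc n)) (at 0) sequentially"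
      by (intro filterlim_atI lim_1_over_n[THEN LIMSEQ_Suc]) auto
    with l have "(\<lambda>n. (f (x + 1 / Suc n) - f x) / (1 / Suc n)) \<longlonglongrightarrow> l"
      unfolding DERIV_def by (rule filterlim_compose)
    then have "g x = l" unfolding g_def by (rule limI)
    with l show ?case by simp
  qed
  ultimately show ?thesis using that by blast
qed

section \<open>The fundamental theorem of calculus for absolutely continuous functions\<close>

text \<open>The gauge is chosen by differentiability at points outside \<open>N\<close>. At points of \<open>N\<close> it is a fixed open
  set \<open>T\<close> of tiny measure that contains \<open>N\<close>: the intervals tagged in \<open>N\<close> then have small total length, so by
  absolute continuity the increments of \<open>f\<close> over them add up to little.\<close>

theorem abs_continuous_FTC:
  assumes "a \<le> b" and ac: "abs_continuous_on_interval a b f" and N: "negligible N"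
    and der: "\<And>x. x \<in> {a..b} - N \<Longrightarrow> (f has_real_derivative g x) (at x)"
  shows "(g has_integral (f b - f a)) {a..b}"
proof -
  define g0 where "g0 x = (if x \<in> N then 0 else g x)" for x
  have "(g0 has_integral (f b - f a)) {a..b}"
    unfolding has_integral_real
  proof (intro allI impI)
    fix e :: real assume "e > 0"
    obtain d where "d > 0" and small: "\<forall>(n::nat) u v.
        (\<forall>i<n. a \<le> u i \<and> u i \<le> v i \<and> v i \<le> b) \<longrightarrow>
        (\<forall>i<n. \<forall>j<n. i \<noteq> j \<longrightarrow> {u i<..<v i} \<inter> {u j<..<v j} = {}) \<longrightarrow>
        (\<Sum>i<n. v i - u i) < d \<longrightarrow> (\<Sum>i<n. \<bar>f (v i) - f (u i)\<bar>) < e / 2"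
      using ac[unfolded abs_continuous_on_interval_def, rule_format, of "e/2"] \<open>e > 0\<close> by auto
    have N': "N \<in> null_sets lebesgue" using N by (simp add: negligible_iff_null_sets)
    then have "N \<in> sets lebesgue" by auto
    then obtain T where T: "open T" "N \<subseteq> T" "(T - N) \<in> lmeasurable"
        "emeasure lebesgue (T - N) < ennreal d"
      by (rule sets_lebesgue_outer_open[OF _ \<open>d > 0\<close>])
    have "emeasure lebesgue (T - N) = emeasure lebesgue T"
      using N' T(1) by (intro emeasure_Diff_null_set) auto
    with T have T_small: "emeasure lebesgue T < ennreal d" by simp
    define c where "c = e / (2 * (b - a + 1))"
    have "c > 0" using \<open>e > 0\<close> \<open>a \<le> b\<close> by (simp add: c_def)
    have "c * (b - a) \<le> c * (b - a + 1)" using \<open>c > 0\<close> by (intro mult_left_mono) auto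
    also have "\<dots> = e / 2" using \<open>a \<le> b\<close> by (simp add: c_def field_simps)
    finally have c_le: "c * (b - a) \<le> e / 2" .
    have "\<exists>r>0. \<forall>y. \<bar>y - x\<bar> < r \<longrightarrow> \<bar>f y - f x - (y - x) * g x\<bar> \<le> c * \<bar>y - x\<bar>"
      if "x \<in> {a..b} - N" for x
      using der[OF that, unfolded has_field_derivative_def has_derivative_at_alt] \<open>c > 0\<close>
      by (auto simp: mult.commute)
    then obtain r where r: "\<And>x. x \<in> {a..b} - N \<Longrightarrow> r x > 0"
      "\<And>x y. x \<in> {a..b} - N \<Longrightarrow> \<bar>y - x\<bar> < r x \<Longrightarrow> \<bar>f y - f x - (y - x) * g x\<bar> \<le> c * \<bar>y - x\<bar>"
      by metis
    define \<gamma> where "\<gamma> x = (if x \<in> N then T else if x \<in> {a..b} then ball x (r x) else UNIV)" for x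
    have "gauge \<gamma>"
      using T r(1) by (auto simp: gauge_def \<gamma>_def)
    moreover have "norm ((\<Sum>(x, K)\<in>p. measure lborel K *\<^sub>R g0 x) - (f b - f a)) < e"
      if p: "p tagged_division_of {a..b}" and fine: "\<gamma> fine p" for p
    proof -
      define L where "L = (\<lambda>K::real set. Inf K)"
      define R where "R = (\<lambda>K::real set. Sup K)"
      have K: "K = {L K..R K}" "L K \<le> R K" "a \<le> L K" "R K \<le> b" "x \<in> K" "K \<subseteq> \<gamma> x"
        if xK: "(x, K) \<in> p" for x K
      proof -
        obtain u v where uv: "K = cbox u v" using tagged_division_ofD(4)[OF p xK] by blast
        show "x \<in> K" using tagged_division_ofD(2)[OF p xK] .
        then have "u \<le> v" using uv by auto
        then show "K = {L K..R K}" "L K \<le> R K" using uv by (auto simp: L_def R_def)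
        then have "{L K..R K} \<subseteq> {a..b}" using tagged_division_ofD(3)[OF p xK] by metis
        then show "a \<le> L K" "R K \<le> b" using \<open>L K \<le> R K\<close> by auto
        show "K \<subseteq> \<gamma> x" using fine xK by (auto simp: fine_def)
      qed
      define p1 where "p1 = {xK \<in> p. fst xK \<in> N}"
      define p2 where "p2 = {xK \<in> p. fst xK \<notin> N}"
      have fin: "finite p" "finite p1" "finite p2" and split: "p = p1 \<union> p2" "p1 \<inter> p2 = {}"
        using tagged_division_ofD(1)[OF p] by (auto simp: p1_def p2_def)
      define \<Delta> where "\<Delta> = (\<lambda>(x::real, K). measure lborel K *\<^sub>R g0 x - (f (R K) - f (L K)))"
      have "(\<Sum>(x, K)\<in>p. measure lborel K *\<^sub>R g0 x) - (f b - f a)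
          = (\<Sum>(x, K)\<in>p. measure lborel K *\<^sub>R g0 x) - (\<Sum>(x, K)\<in>p. f (R K) - f (L K))"
        using additive_tagged_division_1[OF \<open>a \<le> b\<close> p, of f] by (simp add: L_def R_def)
      also have "\<dots> = sum \<Delta> p"
        by (simp add: \<Delta>_def sum_subtractf split_def)
      also have "\<dots> = sum \<Delta> p1 + sum \<Delta> p2"
        unfolding split(1) using fin split(2) by (intro sum.union_disjoint)
      finally have eq: "(\<Sum>(x, K)\<in>p. measure lborel K *\<^sub>R g0 x) - (f b - f a)
          = sum \<Delta> p1 + sum \<Delta> p2" .
      have "\<bar>sum \<Delta> p2\<bar> \<le> e / 2"
      proof -
        have "\<bar>sum \<Delta> p2\<bar> \<le> (\<Sum>(x, K)\<in>p2. c * (R K - L K))"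
        proof (rule order_trans[OF sum_abs], rule sum_mono, clarify)
          fix x K assume "(x, K) \<in> p2"
          then have xK: "(x, K) \<in> p" "x \<notin> N" by (auto simp: p2_def)
          have x': "L K \<le> x" "x \<le> R K" using K(1,5)[OF xK(1)] by (metis atLeastAtMost_iff)+
          then have x: "x \<in> {a..b} - N" using K(3,4)[OF xK(1)] xK(2) by auto
          have "L K \<in> K" "R K \<in> K"
            using K(1,2)[OF xK(1)] by (metis atLeastAtMost_iff order_refl)+
          then have "\<bar>L K - x\<bar> < r x" "\<bar>R K - x\<bar> < r x"
            using K(6)[OF xK(1)] x xK(2) by (auto simp: \<gamma>_def dist_real_def abs_minus_commute)
          then have "\<bar>f (L K) - f x - (L K - x) * g x\<bar> \<le> c * \<bar>L K - x\<bar>"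
            "\<bar>f (R K) - f x - (R K - x) * g x\<bar> \<le> c * \<bar>R K - x\<bar>"
            using r(2)[OF x] by auto
          moreover have "measure lborel K = R K - L K"
            using K(1,2)[OF xK(1)] content_real by metis
          moreover have "c * \<bar>L K - x\<bar> + c * \<bar>R K - x\<bar> = c * (R K - L K)"
            using x' by (simp add: algebra_simps)
          moreover have "(R K - L K) * g x - (f (R K) - f (L K))
              = (f (L K) - f x - (L K - x) * g x) - (f (R K) - f x - (R K - x) * g x)"
            by (simp add: algebra_simps)
          ultimately show "\<bar>\<Delta> (x, K)\<bar> \<le> c * (R K - L K)"
            using xK(2) by (simp add: \<Delta>_def g0_def)
        qed
        also have "\<dots> \<le> (\<Sum>(x, K)\<in>p. c * (R K - L K))"
        proof (rule sum_mono2)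
          show "0 \<le> (case xK of (x, K) \<Rightarrow> c * (R K - L K))" if "xK \<in> p - p2" for xK
            using that K(2)[of "fst xK" "snd xK"] \<open>c > 0\<close> by (simp add: split_def)
        qed (use fin split in auto)
        also have "\<dots> = c * (b - a)"
          using additive_tagged_division_1[OF \<open>a \<le> b\<close> p, of "\<lambda>x. x"]
          by (simp add: L_def R_def sum_distrib_left[symmetric] split_def)
        finally show ?thesis using c_le by simp
      qed
      moreover have "\<bar>sum \<Delta> p1\<bar> < e / 2"
      proof -
        obtain h where h: "bij_betw h {0..<card p1} p1"
          using ex_bij_betw_nat_finite[OF fin(2)] by blast
        define n where "n = card p1"
        have hp: "(fst (h i), snd (h i)) \<in> p" "fst (h i) \<in> N" if "i < n" for i
          using bij_betwE[OF h] that by (auto simp: n_def p1_def)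
        define u where "u i = L (snd (h i))" for i
        define v where "v i = R (snd (h i))" for i
        have int: "interior (snd (h i)) = {u i<..<v i}" if "i < n" for i
          using K(1)[OF hp(1)[OF that]] unfolding u_def v_def by (metis interior_atLeastAtMost_real)
        have disj: "{u i<..<v i} \<inter> {u j<..<v j} = {}" if "i < n" "j < n" "i \<noteq> j" for i j
        proof -
          have "h i \<noteq> h j"
            using h that by (auto simp: bij_betw_def inj_on_def n_def)
          then show ?thesis
            using tagged_division_ofD(5)[OF p hp(1)[OF that(1)] hp(1)[OF that(2)]] int that
            by (simp add: prod_eq_iff)
        qed
        have sub: "{u i<..<v i} \<subseteq> T" if "i < n" for i
          using int[OF that] interior_subset[of "snd (h i)"] K(6)[OF hp(1)[OF that]] hp(2)[OF that]
          by (auto simp: \<gamma>_def)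
        have "ennreal (\<Sum>i<n. v i - u i) = (\<Sum>i<n. emeasure lebesgue {u i<..<v i})"
        proof -
          have "u i \<le> v i" if "i < n" for i
            using K(2)[OF hp(1)[OF that]] by (simp add: u_def v_def)
          then show ?thesis by (subst sum_ennreal[symmetric]) auto
        qed
        also have "\<dots> = emeasure lebesgue (\<Union>i<n. {u i<..<v i})"
          using disj by (intro sum_emeasure) (auto simp: disjoint_family_on_def)
        also have "\<dots> \<le> emeasure lebesgue T"
          using sub T(1) by (intro emeasure_mono) auto
        finally have "ennreal (\<Sum>i<n. v i - u i) < ennreal d" using T_small by (rule le_less_trans)
        moreover have "0 \<le> (\<Sum>i<n. v i - u i)"
        proof (rule sum_nonneg)
          show "0 \<le> v i - u i" if "i \<in> {..<n}" for i
            using K(2)[OF hp(1), of i] that by (simp add: u_def v_def)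
        qed
        ultimately have "(\<Sum>i<n. v i - u i) < d" by (simp add: ennreal_less_iff)
        then have "(\<Sum>i<n. \<bar>f (v i) - f (u i)\<bar>) < e / 2"
        proof (intro small[rule_format])
          show "{u i<..<v i} \<inter> {u j<..<v j} = {}" if "i < n" "j < n" "i \<noteq> j" for i j
            using disj that .
          show "a \<le> u i \<and> u i \<le> v i \<and> v i \<le> b" if "i < n" for i
            using K(2,3,4)[OF hp(1)[OF that]] by (simp add: u_def v_def)
        qed
        moreover have "sum \<Delta> p1 = (\<Sum>i<n. \<Delta> (h i))"
          using sum.reindex_bij_betw[OF h, of \<Delta>] by (simp add: n_def lessThan_atLeast0)
        moreover
        have "\<Delta> (h i) = - (f (v i) - f (u i))" if "i < n" for i
          using hp(2)[OF that] by (simp add: \<Delta>_def g0_def u_def v_def split_def)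
        then have "(\<Sum>i<n. \<Delta> (h i)) = - (\<Sum>i<n. f (v i) - f (u i))"
          by (simp add: sum_negf[symmetric])
        ultimately show ?thesis
          using sum_abs[of "\<lambda>i. f (v i) - f (u i)" "{..<n}"] by linarith
      qed
      ultimately show ?thesis unfolding eq real_norm_def by linarith
    qed
    ultimately show "\<exists>\<gamma>. gauge \<gamma> \<and> (\<forall>p. p tagged_division_of {a..b} \<and> \<gamma> fine p \<longrightarrow>
        norm ((\<Sum>(x, K)\<in>p. measure lborel K *\<^sub>R g0 x) - (f b - f a)) < e)"
      by (intro exI[of _ \<gamma>] conjI allI impI) auto
  qed
  moreover have "g x = g0 x" if "x \<in> {a..b} - N" for x
    using that by (simp add: g0_def)
  ultimately show ?thesis using has_integral_spike[OF N, of "{a..b}" g g0] by metis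
qed

lemma abs_continuous_dominated:
  assumes "abs_continuous_on_interval a b f" "C \<ge> 0"
    and P: "\<And>u v. a \<le> u \<Longrightarrow> u \<le> v \<Longrightarrow> v \<le> b \<Longrightarrow> \<bar>P v - P u\<bar> \<le> C * (\<bar>f v - f u\<bar> + (v - u))"
  shows "abs_continuous_on_interval a b P"
  unfolding abs_continuous_on_interval_def
proof (intro allI impI)
  fix e :: real assume "e > 0"
  define e' where "e' = e / (2 * (C + 1))"
  have "e' > 0" using \<open>e > 0\<close> assms(2) by (simp add: e'_def)
  have "C * e' \<le> (C + 1) * e'" using \<open>e' > 0\<close> by (intro mult_right_mono) auto
  also have "\<dots> = e / 2" using assms(2) by (simp add: e'_def field_simps)
  finally have Ce: "C * e' \<le> e / 2" .
  obtain d where "d > 0" and small: "\<forall>(n::nat) u v.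
        (\<forall>i<n. a \<le> u i \<and> u i \<le> v i \<and> v i \<le> b) \<longrightarrow>
        (\<forall>i<n. \<forall>j<n. i \<noteq> j \<longrightarrow> {u i<..<v i} \<inter> {u j<..<v j} = {}) \<longrightarrow>
        (\<Sum>i<n. v i - u i) < d \<longrightarrow> (\<Sum>i<n. \<bar>f (v i) - f (u i)\<bar>) < e'"
    using assms(1)[unfolded abs_continuous_on_interval_def, rule_format, of e'] \<open>e' > 0\<close> by auto
  have bound: "(\<Sum>i<n. \<bar>P (v i) - P (u i)\<bar>) < e"
    if "\<forall>i<n. a \<le> u i \<and> u i \<le> v i \<and> v i \<le> b"
      "\<forall>i<n. \<forall>j<n. i \<noteq> j \<longrightarrow> {u i<..<v i} \<inter> {u j<..<v j} = {}"
      "(\<Sum>i<n. v i - u i) < min d e'" for n :: nat and u v :: "nat \<Rightarrow> real"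
  proof -
    have "(\<Sum>i<n. \<bar>P (v i) - P (u i)\<bar>) \<le> (\<Sum>i<n. C * (\<bar>f (v i) - f (u i)\<bar> + (v i - u i)))"
      using P that(1) by (intro sum_mono) auto
    also have "\<dots> = C * (\<Sum>i<n. \<bar>f (v i) - f (u i)\<bar>) + C * (\<Sum>i<n. v i - u i)"
      by (simp add: sum_distrib_left sum.distrib distrib_left)
    finally have le: "(\<Sum>i<n. \<bar>P (v i) - P (u i)\<bar>)
        \<le> C * (\<Sum>i<n. \<bar>f (v i) - f (u i)\<bar>) + C * (\<Sum>i<n. v i - u i)" .
    have lt: "(\<Sum>i<n. \<bar>f (v i) - f (u i)\<bar>) < e'" "(\<Sum>i<n. v i - u i) < e'"
      using small that by auto
    show ?thesis
    proof (cases "C = 0")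
      case True
      then show ?thesis using le \<open>e > 0\<close> by simp
    next
      case False
      then have "C > 0" using assms(2) by simp
      then have "C * (\<Sum>i<n. \<bar>f (v i) - f (u i)\<bar>) < C * e'" "C * (\<Sum>i<n. v i - u i) < C * e'"
        using lt by simp_all
      then show ?thesis using le Ce by simp
    qed
  qed
  show "\<exists>d>0. \<forall>(n::nat) u v.
        (\<forall>i<n. a \<le> u i \<and> u i \<le> v i \<and> v i \<le> b) \<longrightarrow>
        (\<forall>i<n. \<forall>j<n. i \<noteq> j \<longrightarrow> {u i<..<v i} \<inter> {u j<..<v j} = {}) \<longrightarrow>
        (\<Sum>i<n. v i - u i) < d \<longrightarrow> (\<Sum>i<n. \<bar>P (v i) - P (u i)\<bar>) < e"
  proof (intro exI conjI allI impI)
    show "0 < min d e'" using \<open>d > 0\<close> \<open>e' > 0\<close> by simp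
  qed (rule bound)
qed

lemma locally_abs_continuous_imp_continuous:
  assumes "locally_abs_continuous f"
  shows "continuous_on UNIV f"
proof (rule continuous_at_imp_continuous_on, rule ballI)
  fix x :: real
  have "abs_continuous_on_interval (x - 1) (x + 1) f"
    using assms by (simp add: locally_abs_continuous_def)
  then have "continuous_on {x - 1..x + 1} f"
    by (rule abs_continuous_diff_mono)
  then show "isCont f x"
    by (rule continuous_on_interior) simp
qed

text \<open>The product rule and the chain rule hold outside a null set, and \<open>G \<circ> f\<close> times \<open>\<theta>\<close> inherits absolute
  continuity from \<open>f\<close> because all factors are Lipschitz on the bounded ranges involved.\<close>

lemma FTC_composed_times_smooth:
  fixes f G G' \<theta> \<theta>' :: "real \<Rightarrow> real"
  assumes f: "locally_abs_continuous f" "AE x in lborel. (f has_real_derivative g x) (at x)"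
    and G: "\<And>t. (G has_real_derivative G' t) (at t)"
      "\<And>r. \<exists>L. \<forall>t. \<bar>t\<bar> \<le> r \<longrightarrow> \<bar>G' t\<bar> \<le> L"
    and \<theta>: "\<And>x. (\<theta> has_real_derivative \<theta>' x) (at x)" "continuous_on UNIV \<theta>'"
    and "a \<le> b"
  shows "((\<lambda>x. G' (f x) * g x * \<theta> x + G (f x) * \<theta>' x) has_integral
          (G (f b) * \<theta> b - G (f a) * \<theta> a)) {a..b}"
proof -
  have bounded_on: "\<exists>B\<ge>0. \<forall>x\<in>{a..b}. \<bar>u x\<bar> \<le> B" if "continuous_on UNIV u" for u :: "real \<Rightarrow> real"
  proof -
    have "compact (u ` {a..b})"
      using that continuous_on_subset by (intro compact_continuous_image) auto
    then obtain B where "\<forall>y\<in>u ` {a..b}. \<bar>y\<bar> \<le> B"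
      using compact_imp_bounded bounded_iff by (metis real_norm_def)
    then show ?thesis by (intro exI[of _ "max B 0"]) auto
  qed
  have f_cont: "continuous_on UNIV f" by (rule locally_abs_continuous_imp_continuous[OF f(1)])
  have G_cont: "continuous_on UNIV G"
    using G(1) DERIV_continuous continuous_at_imp_continuous_on by blast
  have \<theta>_cont: "continuous_on UNIV \<theta>"
    using \<theta>(1) DERIV_continuous continuous_at_imp_continuous_on by blast
  have Gf_cont: "continuous_on UNIV (\<lambda>x. G (f x))"
    using continuous_on_compose2[OF G_cont f_cont] by simp
  obtain r where r: "\<And>x. x \<in> {a..b} \<Longrightarrow> \<bar>f x\<bar> \<le> r" using bounded_on[OF f_cont] by blast
  obtain L0 where L0: "\<And>t. \<bar>t\<bar> \<le> r \<Longrightarrow> \<bar>G' t\<bar> \<le> L0" using G(2) by blast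
  define L where "L = \<bar>L0\<bar>"
  have L: "\<And>t. \<bar>t\<bar> \<le> r \<Longrightarrow> \<bar>G' t\<bar> \<le> L" "L \<ge> 0" using L0 unfolding L_def by fastforce+
  obtain BG where BG: "BG \<ge> 0" "\<And>x. x \<in> {a..b} \<Longrightarrow> \<bar>G (f x)\<bar> \<le> BG" using bounded_on[OF Gf_cont] by blast
  obtain B where B: "B \<ge> 0" "\<And>x. x \<in> {a..b} \<Longrightarrow> \<bar>\<theta> x\<bar> \<le> B" using bounded_on[OF \<theta>_cont] by blast
  obtain B' where B': "B' \<ge> 0" "\<And>x. x \<in> {a..b} \<Longrightarrow> \<bar>\<theta>' x\<bar> \<le> B'" using bounded_on[OF \<theta>(2)] by blast
  have lip: "\<bar>q y - q x\<bar> \<le> c * \<bar>y - x\<bar>"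
    if "\<And>z. (q has_real_derivative q' z) (at z)" "\<And>z. z \<in> S \<Longrightarrow> \<bar>q' z\<bar> \<le> c" "convex S" "x \<in> S" "y \<in> S"
    for q q' :: "real \<Rightarrow> real" and S c x y
    using field_differentiable_bound[of S q q' c y x] that
    by (simp add: has_field_derivative_at_within)
  define C where "C = B * L + BG * B'"
  have C0: "C \<ge> 0" "B * L \<le> C" "BG * B' \<le> C" using B(1) BG(1) B'(1) L(2) by (auto simp: C_def)
  have "abs_continuous_on_interval a b (\<lambda>x. G (f x) * \<theta> x)"
  proof (rule abs_continuous_dominated[OF _ \<open>C \<ge> 0\<close>])
    show "abs_continuous_on_interval a b f"
      using f(1) \<open>a \<le> b\<close> by (simp add: locally_abs_continuous_def)
    fix u v assume uv: "a \<le> u" "u \<le> v" "v \<le> b"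
    have "\<bar>G (f v) - G (f u)\<bar> \<le> L * \<bar>f v - f u\<bar>"
    proof (rule lip[of G G' "{-r..r}"])
      show "f u \<in> {-r..r}" "f v \<in> {-r..r}" using r[of u] r[of v] uv by auto
      show "\<bar>G' z\<bar> \<le> L" if "z \<in> {-r..r}" for z using L(1)[of z] that by auto
    qed (use G(1) in auto)
    then have 1: "\<bar>\<theta> v\<bar> * \<bar>G (f v) - G (f u)\<bar> \<le> B * (L * \<bar>f v - f u\<bar>)"
      using B uv by (intro mult_mono) auto
    have "\<bar>\<theta> v - \<theta> u\<bar> \<le> B' * \<bar>v - u\<bar>"
      using uv B'(2) \<theta>(1) by (intro lip[of \<theta> \<theta>' "{a..b}"]) auto
    then have 2: "\<bar>G (f u)\<bar> * \<bar>\<theta> v - \<theta> u\<bar> \<le> BG * (B' * \<bar>v - u\<bar>)"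
      using BG uv by (intro mult_mono) auto
    have "\<bar>G (f v) * \<theta> v - G (f u) * \<theta> u\<bar> = \<bar>\<theta> v * (G (f v) - G (f u)) + G (f u) * (\<theta> v - \<theta> u)\<bar>"
      by (simp add: algebra_simps)
    also have "\<dots> \<le> \<bar>\<theta> v\<bar> * \<bar>G (f v) - G (f u)\<bar> + \<bar>G (f u)\<bar> * \<bar>\<theta> v - \<theta> u\<bar>"
      by (metis abs_mult abs_triangle_ineq)
    also have "\<dots> \<le> B * L * \<bar>f v - f u\<bar> + BG * B' * (v - u)"
      using 1 2 uv by simp
    also have "\<dots> \<le> C * \<bar>f v - f u\<bar> + C * (v - u)"
      using C0 uv by (intro add_mono mult_right_mono) auto
    finally show "\<bar>G (f v) * \<theta> v - G (f u) * \<theta> u\<bar> \<le> C * (\<bar>f v - f u\<bar> + (v - u))"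
      by (simp add: distrib_left)
  qed
  moreover obtain N where N: "{x. \<not> (f has_real_derivative g x) (at x)} \<subseteq> N" "N \<in> null_sets lborel"
    using f(2) by (auto elim!: AE_E simp: null_sets_def)
  have "negligible N"
    using N(2) by (simp add: negligible_iff_null_sets null_sets_completionI)
  moreover have "((\<lambda>x. G (f x) * \<theta> x) has_real_derivative
      G' (f x) * g x * \<theta> x + G (f x) * \<theta>' x) (at x)" if "x \<in> {a..b} - N" for x
  proof -
    have "(f has_real_derivative g x) (at x)" using that N(1) by auto
    from DERIV_mult[OF DERIV_chain2[OF G(1) this] \<theta>(1)] show ?thesis
      by (simp add: algebra_simps)
  qed
  ultimately show ?thesis
    by (intro abs_continuous_FTC[OF \<open>a \<le> b\<close>])
qed

lemma integrable_if_bounded_on_balls: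
  fixes u :: "real \<Rightarrow> real"
  assumes [measurable]: "u \<in> borel_measurable borel" and nonneg: "\<And>x. 0 \<le> u x"
    and bound: "\<And>n::nat. \<exists>I \<le> c. (u has_integral I) {-real n..real n}"
  shows "integrable lborel u" "(\<integral>x. u x \<partial>lborel) \<le> c"
proof -
  obtain I0 where "I0 \<le> c" "(u has_integral I0) {-real 0..real 0}" using bound by blast
  then have c0: "0 \<le> c" using has_integral_nonneg[of u I0] nonneg by (meson order_trans)
  have below: "(\<integral>\<^sup>+ x. ennreal (u x) * indicator {-real n..real n} x \<partial>lborel) \<le> ennreal c" for n
  proof -
    obtain I where I: "I \<le> c" "(u has_integral I) {-real n..real n}" using bound by blast
    have "(\<integral>\<^sup>+ x. ennreal (u x) * indicator {-real n..real n} x \<partial>lborel) = ennreal I"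
      using I(2) nonneg by (intro nn_integral_has_integral_lebesgue') auto
    then show ?thesis using I(1) by (simp add: ennreal_leI)
  qed
  have "(\<lambda>n. \<integral>\<^sup>+ x. ennreal (u x) * indicator {-real n..real n} x \<partial>lborel)
      \<longlonglongrightarrow> (\<integral>\<^sup>+ x. ennreal (u x) \<partial>lborel)"
  proof (rule nn_integral_LIMSEQ)
    show "incseq (\<lambda>n x. ennreal (u x) * indicator {-real n..real n} x)"
      by (auto simp: incseq_def le_fun_def indicator_def)
    show "(\<lambda>n. ennreal (u x) * indicator {-real n..real n} x) \<longlonglongrightarrow> ennreal (u x)" for x
    proof (rule tendsto_eventually)
      obtain N :: nat where "\<bar>x\<bar> \<le> N" using real_arch_simple by blast
      then show "\<forall>\<^sub>F n in sequentially. ennreal (u x) * indicator {-real n..real n} x = ennreal (u x)"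
        unfolding eventually_sequentially by (intro exI[of _ N]) (auto simp: indicator_def)
    qed
  qed measurable
  then have le: "(\<integral>\<^sup>+ x. ennreal (u x) \<partial>lborel) \<le> ennreal c"
    by (rule LIMSEQ_le_const2) (use below in blast)
  then show int: "integrable lborel u"
    using nonneg by (intro integrableI_nonneg) (auto simp: le_less_trans[OF le])
  have "ennreal (\<integral>x. u x \<partial>lborel) \<le> ennreal c"
    using nn_integral_eq_integral[OF int] nonneg le by simp
  then show "(\<integral>x. u x \<partial>lborel) \<le> c" using c0 by (simp add: ennreal_le_iff)
qed

section \<open>Growth of the potential\<close>

text \<open>Regularity enters in the form that integration by parts against \<open>exp (- \<Phi>)\<close> uses: a continuous
  derivative.\<close>

locale growth_potential =
  fixes \<Phi> :: "real \<Rightarrow> real" and M \<epsilon> :: real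
  assumes even: "\<Phi> (- x) = \<Phi> x"
    and convex: "convex_on UNIV \<Phi>"
    and has_deriv: "(\<Phi> has_real_derivative deriv \<Phi> x) (at x)"
    and deriv_cont: "continuous_on UNIV (deriv \<Phi>)"
    and M_pos: "0 < M" and Phi_M_pos: "0 < \<Phi> M" and eps_pos: "0 < \<epsilon>"
    and growth_lower: "M \<le> x \<Longrightarrow> (1 + \<epsilon>) * \<Phi> x \<le> x * deriv \<Phi> x"
    and growth_upper: "M \<le> x \<Longrightarrow> x * deriv \<Phi> x \<le> (2 - \<epsilon>) * \<Phi> x"
begin

definition \<Psi> :: "real \<Rightarrow> real" where
  "\<Psi> x = \<Phi> x - \<Phi> 0"

lemma Phi_continuous: "continuous_on UNIV \<Phi>"
  using has_deriv DERIV_continuous continuous_at_imp_continuous_on by blast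

lemma Phi_abs: "\<Phi> \<bar>x\<bar> = \<Phi> x"
  using even by (simp add: abs_if)

lemma Psi_abs: "\<Psi> \<bar>x\<bar> = \<Psi> x"
  by (simp add: \<Psi>_def Phi_abs)

lemma deriv_minus: "deriv \<Phi> (- x) = - deriv \<Phi> x"
proof -
  have "((\<lambda>y. \<Phi> (- y)) has_real_derivative deriv \<Phi> (- x) * - 1) (at x)"
    by (rule DERIV_chain2[OF has_deriv]) (auto intro!: derivative_eq_intros)
  moreover have "(\<lambda>y. \<Phi> (- y)) = \<Phi>" using even by auto
  ultimately have "(\<Phi> has_real_derivative deriv \<Phi> (- x) * - 1) (at x)" by simp
  then show ?thesis using DERIV_unique[OF has_deriv] by force
qed

lemma above_tangent: "deriv \<Phi> c * (x - c) \<le> \<Phi> x - \<Phi> c"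
  using convex_on_imp_above_tangent[OF convex, of c x] has_deriv by simp

lemma Psi_nonneg: "0 \<le> \<Psi> x"
  using above_tangent[of 0 x] deriv_minus[of 0] by (simp add: \<Psi>_def)

lemma Psi_le_virial: "\<Psi> x \<le> x * deriv \<Phi> x"
  using above_tangent[of x 0] by (simp add: \<Psi>_def algebra_simps)

lemma Phi_mono: "\<lbrakk>0 \<le> x; x \<le> y\<rbrakk> \<Longrightarrow> \<Phi> x \<le> \<Phi> y"
proof (cases "x = 0")
  case True
  then show ?thesis using Psi_nonneg[of y] by (simp add: \<Psi>_def)
next
  case False
  assume xy: "0 \<le> x" "x \<le> y"
  have "0 \<le> x * deriv \<Phi> x" using Psi_nonneg Psi_le_virial order_trans by blast
  then have "0 \<le> deriv \<Phi> x" using False xy by (simp add: zero_le_mult_iff)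
  then have "0 \<le> deriv \<Phi> x * (y - x)" using xy by simp
  then show ?thesis using above_tangent[of x y] by simp
qed

lemma Phi_pos: "M \<le> x \<Longrightarrow> 0 < \<Phi> x"
  using Phi_mono[of M x] M_pos Phi_M_pos by simp

text \<open>By the lower growth hypothesis the derivative of \<open>\<Phi> z / z\<^bsup>1 + \<epsilon>\<^esup>\<close> is nonnegative for \<open>z \<ge> M\<close>.\<close>

lemma power_growth:
  assumes "M \<le> y" "y \<le> x"
  shows "\<Phi> y \<le> (y / x) powr (1 + \<epsilon>) * \<Phi> x"
proof -
  define p where "p = 1 + \<epsilon>"
  have "\<Phi> y * y powr - p \<le> \<Phi> x * x powr - p"
  proof (rule DERIV_nonneg_imp_nondecreasing[OF assms(2)])
    fix z assume z: "y \<le> z" "z \<le> x"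
    then have "0 < z" "M \<le> z" using assms M_pos by auto
    have "((\<lambda>z. \<Phi> z * z powr - p) has_real_derivative
        deriv \<Phi> z * z powr - p + \<Phi> z * (- p * z powr (- p - 1))) (at z)"
      using \<open>0 < z\<close> by (auto intro!: derivative_eq_intros has_deriv)
    moreover have "deriv \<Phi> z * z powr - p + \<Phi> z * (- p * z powr (- p - 1))
        = z powr (- p - 1) * (z * deriv \<Phi> z - p * \<Phi> z)"
    proof -
      have "z powr - p = z powr (- p - 1) * z"
        using \<open>0 < z\<close> powr_add[of z "- p - 1" 1] by simp
      then show ?thesis by (simp add: algebra_simps)
    qed
    moreover have "0 \<le> z powr (- p - 1) * (z * deriv \<Phi> z - p * \<Phi> z)"
      using growth_lower[OF \<open>M \<le> z\<close>] by (intro mult_nonneg_nonneg) (auto simp: p_def)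
    ultimately show "\<exists>d. ((\<lambda>z. \<Phi> z * z powr - p) has_real_derivative d) (at z) \<and> 0 \<le> d"
      by metis
  qed
  then have "y powr p * (\<Phi> y * y powr - p) \<le> y powr p * (\<Phi> x * x powr - p)"
    by (rule mult_left_mono) simp
  moreover have "0 < x" "0 < y" using assms M_pos by auto
  ultimately show ?thesis
    using powr_divide[of y x p] by (simp add: p_def[symmetric] powr_minus_divide mult.commute)
qed

text \<open>Used with \<open>l\<close> a power of the cutoff ratio: a small factor in front of the argument of \<open>\<Psi>\<close> can be pulled
  out with an exponent larger than one.\<close>

lemma Psi_scaling:
  assumes "0 \<le> l" "l \<le> 1"
  shows "\<Psi> (l * x) \<le> l powr (1 + \<epsilon>) * \<Psi> x + (2 * \<bar>\<Phi> 0\<bar> + \<Psi> M)"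
proof -
  have *: "\<Psi> (l * x) \<le> l powr (1 + \<epsilon>) * \<Psi> x + (2 * \<bar>\<Phi> 0\<bar> + \<Psi> M)" if "x \<ge> 0" for x
  proof (cases "l * x < M")
    case True
    then have "\<Psi> (l * x) \<le> \<Psi> M"
      using Phi_mono[of "l * x" M] assms that by (simp add: \<Psi>_def)
    moreover have "0 \<le> l powr (1 + \<epsilon>) * \<Psi> x" using Psi_nonneg by simp
    ultimately show ?thesis by linarith
  next
    case False
    then have "x \<noteq> 0" using M_pos by auto
    then have "x > 0" using that by simp
    then have "\<Phi> (l * x) \<le> l powr (1 + \<epsilon>) * \<Phi> x"
      using power_growth[of "l * x" x] False assms mult_left_le_one_le[of x l] by simp
    also have "\<dots> = l powr (1 + \<epsilon>) * \<Psi> x + l powr (1 + \<epsilon>) * \<Phi> 0"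
      by (simp add: \<Psi>_def algebra_simps)
    finally have "\<Psi> (l * x) \<le> l powr (1 + \<epsilon>) * \<Psi> x + (l powr (1 + \<epsilon>) * \<Phi> 0 - \<Phi> 0)"
      by (simp add: \<Psi>_def)
    moreover have "l powr (1 + \<epsilon>) * \<Phi> 0 \<le> \<bar>\<Phi> 0\<bar>"
    proof -
      have "l powr (1 + \<epsilon>) * \<Phi> 0 \<le> l powr (1 + \<epsilon>) * \<bar>\<Phi> 0\<bar>" by (intro mult_left_mono) auto
      also have "\<dots> \<le> 1 * \<bar>\<Phi> 0\<bar>"
        using assms eps_pos by (intro mult_right_mono powr_le1) auto
      finally show ?thesis by simp
    qed
    ultimately show ?thesis using Psi_nonneg[of M] by linarith
  qed
  show ?thesis
    using *[of "\<bar>x\<bar>"] Psi_abs[of "l * x"] Psi_abs[of x] assms(1) by (simp add: abs_mult)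
qed

text \<open>The hypothesis at \<open>x \<ge> M\<close>, extended to the whole line at the price of an additive constant. The factor
  \<open>1 + \<epsilon>\<close> is what makes the absorption in \<open>virial_pointwise\<close> possible.\<close>

lemma virial_lower_bound:
  "(1 + \<epsilon>) * \<Psi> x - (1 + \<epsilon>) * (\<bar>\<Phi> 0\<bar> + \<Psi> M) \<le> x * deriv \<Phi> x"
proof -
  have *: "(1 + \<epsilon>) * \<Psi> x - (1 + \<epsilon>) * (\<bar>\<Phi> 0\<bar> + \<Psi> M) \<le> x * deriv \<Phi> x" if "x \<ge> 0" for x
  proof (cases "x < M")
    case True
    then have "\<Psi> x \<le> \<bar>\<Phi> 0\<bar> + \<Psi> M" using Phi_mono[of x M] that by (simp add: \<Psi>_def)
    then have "(1 + \<epsilon>) * \<Psi> x \<le> (1 + \<epsilon>) * (\<bar>\<Phi> 0\<bar> + \<Psi> M)"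
      using eps_pos by (intro mult_left_mono) auto
    then show ?thesis using Psi_le_virial[of x] Psi_nonneg[of x] by linarith
  next
    case False
    have "(1 + \<epsilon>) * (\<Psi> x - (\<bar>\<Phi> 0\<bar> + \<Psi> M)) \<le> (1 + \<epsilon>) * \<Phi> x"
      using eps_pos Psi_nonneg[of M] by (intro mult_left_mono) (auto simp: \<Psi>_def)
    then show ?thesis using growth_lower[of x] False by (simp add: right_diff_distrib)
  qed
  show ?thesis
    using *[of "\<bar>x\<bar>"] Psi_abs[of x] deriv_minus[of x] by (cases "x \<ge> 0") auto
qed

text \<open>Beyond \<open>M\<close> this is the upper growth hypothesis divided by \<open>x\<close>; below \<open>M\<close> it comes from convexity, which
  bounds \<open>\<Phi>' x\<close> by the increment of \<open>\<Phi>\<close> over \<open>[x, x + 1]\<close>.\<close>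

lemma deriv_bound:
  obtains C where "C \<ge> 0" "\<And>x. \<bar>deriv \<Phi> x\<bar> \<le> C * (1 + \<Psi> x)"
proof -
  define C where "C = \<Psi> (M + 1) + 2 / M * (1 + \<bar>\<Phi> 0\<bar>)"
  have C0: "0 \<le> C" "\<Psi> (M + 1) \<le> C" "2 / M * (1 + \<bar>\<Phi> 0\<bar>) \<le> C"
    using Psi_nonneg[of "M + 1"] M_pos by (auto simp: C_def)
  have pos: "deriv \<Phi> x \<le> C * (1 + \<Psi> x)" "0 \<le> deriv \<Phi> x" if "x \<ge> 0" for x
  proof -
    show "0 \<le> deriv \<Phi> x"
      using Psi_le_virial[of x] Psi_nonneg[of x] deriv_minus[of 0] that
      by (cases "x = 0") (auto simp: zero_le_mult_iff dest: order_trans)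
    show "deriv \<Phi> x \<le> C * (1 + \<Psi> x)"
    proof (cases "x < M")
      case True
      have "deriv \<Phi> x \<le> \<Phi> (x + 1) - \<Phi> x" using above_tangent[of x "x + 1"] by simp
      also have "\<dots> \<le> \<Psi> (M + 1)"
        using Phi_mono[of "x + 1" "M + 1"] Phi_mono[of 0 x] True that by (simp add: \<Psi>_def)
      also have "\<dots> \<le> C * 1" using C0 by simp
      also have "\<dots> \<le> C * (1 + \<Psi> x)" using C0 Psi_nonneg[of x] by (intro mult_left_mono) auto
      finally show ?thesis .
    next
      case False
      have "M * deriv \<Phi> x \<le> x * deriv \<Phi> x"
        using \<open>0 \<le> deriv \<Phi> x\<close> False by (intro mult_right_mono) auto
      also have "\<dots> \<le> (2 - \<epsilon>) * \<Phi> x" using growth_upper[of x] False by simp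
      also have "\<dots> \<le> 2 * \<Phi> x"
        using eps_pos Phi_pos[of x] False by (intro mult_right_mono) auto
      also have "\<dots> \<le> 2 * ((1 + \<bar>\<Phi> 0\<bar>) * (1 + \<Psi> x))"
      proof -
        have "\<Phi> x \<le> \<Psi> x + \<bar>\<Phi> 0\<bar>" by (simp add: \<Psi>_def)
        also have "\<dots> \<le> (1 + \<bar>\<Phi> 0\<bar>) * (1 + \<Psi> x)"
          using Psi_nonneg[of x] by (simp add: distrib_left distrib_right)
        finally show ?thesis by simp
      qed
      finally have "deriv \<Phi> x \<le> 2 / M * (1 + \<bar>\<Phi> 0\<bar>) * (1 + \<Psi> x)"
        using M_pos by (simp add: field_simps)
      also have "\<dots> \<le> C * (1 + \<Psi> x)"
        using C0 Psi_nonneg[of x] by (intro mult_right_mono) auto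
      finally show ?thesis .
    qed
  qed
  have "\<bar>deriv \<Phi> x\<bar> \<le> C * (1 + \<Psi> x)" for x
    using pos[of "\<bar>x\<bar>"] deriv_minus[of x] Psi_abs[of x] by (cases "x \<ge> 0") auto
  then show ?thesis using that C0 by blast
qed

section \<open>The Legendre transform and the cost function\<close>

text \<open>Since \<open>\<Phi> y\<close> grows at least like \<open>\<bar>y\<bar>\<^bsup>1 + \<epsilon>\<^esup>\<close>, it beats every linear function; hence its Legendre transform is
  finite.\<close>

lemma superlinear:
  assumes "B \<ge> 0"
  obtains C where "C \<ge> 0" "\<And>y. B * \<bar>y\<bar> \<le> \<Phi> y + C"
proof -
  define c where "c = \<Phi> M / M powr (1 + \<epsilon>)"
  have "c > 0" using Phi_M_pos M_pos by (simp add: c_def)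
  define t0 where "t0 = max M ((B / c) powr (1 / \<epsilon>))"
  define C where "C = B * t0 + \<bar>\<Phi> 0\<bar>"
  have "t0 > 0" using M_pos by (simp add: t0_def)
  have "B * \<bar>y\<bar> \<le> \<Phi> y + C" for y
  proof (cases "\<bar>y\<bar> \<le> t0")
    case True
    then have "B * \<bar>y\<bar> \<le> B * t0" using assms by (intro mult_left_mono) auto
    then show ?thesis using Psi_nonneg[of y] by (simp add: C_def \<Psi>_def)
  next
    case False
    then have y: "M \<le> \<bar>y\<bar>" "(B / c) powr (1 / \<epsilon>) \<le> \<bar>y\<bar>" "0 < \<bar>y\<bar>"
      using M_pos by (auto simp: t0_def)
    have "B / c = ((B / c) powr (1 / \<epsilon>)) powr \<epsilon>"
      using eps_pos assms \<open>c > 0\<close> by (cases "B = 0") (simp_all add: powr_powr)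
    also have "\<dots> \<le> \<bar>y\<bar> powr \<epsilon>" using y eps_pos by (intro powr_mono2) auto
    finally have "B \<le> c * \<bar>y\<bar> powr \<epsilon>" using \<open>c > 0\<close> by (simp add: field_simps)
    then have "B * \<bar>y\<bar> \<le> c * \<bar>y\<bar> powr \<epsilon> * \<bar>y\<bar>" by (intro mult_right_mono) auto
    also have "\<dots> = c * \<bar>y\<bar> powr (1 + \<epsilon>)" using y by (simp add: powr_add)
    also have "\<dots> \<le> \<Phi> \<bar>y\<bar>"
      using power_growth[OF order_refl y(1)] y M_pos
      by (simp add: c_def powr_divide field_simps)
    also have "\<dots> \<le> \<Phi> y + C"
      using assms \<open>t0 > 0\<close> by (simp add: Phi_abs C_def)
    finally show ?thesis .
  qed
  moreover have "C \<ge> 0" using assms \<open>t0 > 0\<close> by (simp add: C_def)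
  ultimately show ?thesis using that by blast
qed

lemma legendre_fenchel_finite: "\<bar>legendre_fenchel \<Phi> s\<bar> \<noteq> \<infinity>"
proof -
  obtain C where C: "\<And>y. \<bar>s\<bar> * \<bar>y\<bar> \<le> \<Phi> y + C" using superlinear[of "\<bar>s\<bar>"] by auto
  have "s * y - \<Phi> y \<le> C" for y
    using C[of y] abs_ge_self[of "s * y"] by (simp add: abs_mult)
  then have "legendre_fenchel \<Phi> s \<le> ereal C"
    unfolding legendre_fenchel_def by (intro SUP_least) simp
  moreover have "ereal (s * 0 - \<Phi> 0) \<le> legendre_fenchel \<Phi> s"
    unfolding legendre_fenchel_def by (rule SUP_upper) simp
  ultimately show ?thesis by (cases "legendre_fenchel \<Phi> s") auto
qed

text \<open>A supremum of continuous functions is lower semicontinuous.\<close>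

lemma legendre_fenchel_measurable: "legendre_fenchel \<Phi> \<in> borel_measurable borel"
proof (rule borel_measurableI_greater)
  fix c :: ereal
  have "{s \<in> space borel. c < legendre_fenchel \<Phi> s} = (\<Union>y. {s. c < ereal (s * y - \<Phi> y)})"
    by (auto simp: legendre_fenchel_def less_SUP_iff)
  also have "open \<dots>"
    by (intro open_UN ballI open_Collect_less continuous_intros)
  finally show "{s \<in> space borel. c < legendre_fenchel \<Phi> s} \<in> sets borel" by simp
qed

text \<open>With \<open>D = 1\<close> and \<open>B\<close> large the cost function is finite, nonnegative, and grows at least linearly, and Young's
  inequality holds with the prescribed factor \<open>K\<close>. For \<open>\<bar>s\<bar> \<le> 1\<close> the cost may be close to zero, and
  \<open>K \<bar>y\<bar> \<le> \<Phi> y + const\<close> takes the place of Young's inequality.\<close>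

lemma H_fun_real:
  assumes "K \<ge> 0"
  obtains B C h where "B \<ge> 0" "C \<ge> 0" "h \<in> borel_measurable borel"
    "\<And>s. H_fun \<Phi> B 1 s = ereal (h s)" "\<And>s. 0 \<le> h s" "\<And>s. \<bar>s\<bar> \<le> 1 + h s"
    "\<And>s y. K * \<bar>s\<bar> * \<bar>y\<bar> \<le> \<Psi> y + h s + C"
proof -
  define B where "B = K + 1 + \<bar>\<Phi> 1\<bar>"
  obtain CK where CK: "CK \<ge> 0" "\<And>y. K * \<bar>y\<bar> \<le> \<Phi> y + CK" using superlinear[OF assms] by blast
  define h where "h s = real_of_ereal (H_fun \<Phi> B 1 s)" for s
  have H: "H_fun \<Phi> B 1 s = ereal (h s)" for s
    using legendre_fenchel_finite[of "B * s"] by (auto simp: h_def H_fun_def ereal_real)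
  have small: "h s = s\<^sup>2" if "\<bar>s\<bar> \<le> 1" for s
    using that by (simp add: h_def H_fun_def)
  have young: "B * \<bar>s\<bar> * \<bar>y\<bar> - \<Phi> y \<le> h s" if "\<bar>s\<bar> > 1" for s y
  proof -
    \<comment> \<open>the supremum is tested at the sign of \<open>y\<close> that makes the product nonnegative; \<open>\<Phi>\<close> is even\<close>
    define z where "z = (if s * y \<ge> 0 then y else - y)"
    have "ereal (B * s * z - \<Phi> z) \<le> legendre_fenchel \<Phi> (B * s)"
      unfolding legendre_fenchel_def by (rule SUP_upper) simp
    also have "\<dots> = ereal (h s)" using H[of s] that by (simp add: H_fun_def)
    finally have "B * s * z - \<Phi> z \<le> h s" by simp
    moreover have "\<Phi> z = \<Phi> y" by (simp add: z_def even)
    moreover have "s * z = \<bar>s * y\<bar>" by (simp add: z_def)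
    ultimately show ?thesis by (simp add: abs_mult mult.assoc)
  qed
  have large: "\<bar>s\<bar> \<le> h s" if "\<bar>s\<bar> > 1" for s
  proof -
    have "\<Phi> 1 + \<bar>s\<bar> \<le> \<bar>\<Phi> 1\<bar> * \<bar>s\<bar> + \<bar>s\<bar>"
      using that mult_left_mono[of 1 "\<bar>s\<bar>" "\<bar>\<Phi> 1\<bar>"] by auto
    also have "\<dots> \<le> B * \<bar>s\<bar>" using assms by (simp add: B_def algebra_simps)
    finally show ?thesis using young[OF that, of 1] by simp
  qed
  show ?thesis
  proof (rule that[of B "CK + \<bar>\<Phi> 0\<bar>" h])
    show "B \<ge> 0" "CK + \<bar>\<Phi> 0\<bar> \<ge> 0" using assms CK by (auto simp: B_def)
    show "h \<in> borel_measurable borel"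
    proof -
      have [measurable]: "(\<lambda>s. legendre_fenchel \<Phi> (B * s)) \<in> borel_measurable borel"
        by (rule measurable_compose[OF _ legendre_fenchel_measurable]) simp
      show ?thesis unfolding h_def H_fun_def by measurable
    qed
    show "H_fun \<Phi> B 1 s = ereal (h s)" for s by (rule H)
    show h0: "0 \<le> h s" for s
      using small[of s] large[of s] by (cases "\<bar>s\<bar> \<le> 1") auto
    show "\<bar>s\<bar> \<le> 1 + h s" for s
      using small[of s] large[of s] by (cases "\<bar>s\<bar> \<le> 1") (auto intro: add_increasing2)
    show "K * \<bar>s\<bar> * \<bar>y\<bar> \<le> \<Psi> y + h s + (CK + \<bar>\<Phi> 0\<bar>)" for s y
    proof (cases "\<bar>s\<bar> \<le> 1")
      case True
      have "K * \<bar>s\<bar> * \<bar>y\<bar> \<le> K * 1 * \<bar>y\<bar>"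
        using assms True by (intro mult_right_mono mult_left_mono) auto
      then show ?thesis using CK(2)[of y] h0[of s] by (simp add: \<Psi>_def)
    next
      case False
      have "K * \<bar>s\<bar> * \<bar>y\<bar> \<le> B * \<bar>s\<bar> * \<bar>y\<bar>"
        by (intro mult_right_mono) (auto simp: B_def)
      then show ?thesis using young[of s y] False CK(1) abs_ge_self[of "\<Phi> 0"]
        unfolding \<Psi>_def by linarith
    qed
  qed
qed

end

section \<open>The cutoff\<close>

text \<open>The square, multiplied by a power of the ratio \<open>1 - 2/t \<in> [0, 1)\<close>. A high power is essential: the
  derivative carries the ratio to the power \<open>m\<close>, and \<open>\<Psi>\<close> of an argument shrunk by that factor gains the
  power \<open>m (1 + \<epsilon>)\<close>. This has to be at least \<open>m + 1\<close>, the power in the cutoff itself, for the term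
  to be absorbed, whence the requirement \<open>m \<epsilon> \<ge> 1\<close>.\<close>

definition cutoff :: "nat \<Rightarrow> real \<Rightarrow> real" where
  "cutoff m t = (if t \<le> 2 then 0 else t\<^sup>2 * (1 - 2 / t) ^ Suc m)"

definition cutoff_deriv :: "nat \<Rightarrow> real \<Rightarrow> real" where
  "cutoff_deriv m t =
     (if t \<le> 2 then 0 else 2 * t * (1 - 2 / t) ^ Suc m + 2 * Suc m * (1 - 2 / t) ^ m)"

lemma cutoff_le_square: "0 \<le> cutoff m t" "cutoff m t \<le> t\<^sup>2"
proof -
  show "0 \<le> cutoff m t" by (auto simp: cutoff_def)
  have "t\<^sup>2 * (1 - 2 / t) ^ Suc m \<le> t\<^sup>2 * 1" if "\<not> t \<le> 2"
    using that by (intro mult_left_mono power_le_one) auto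
  then show "cutoff m t \<le> t\<^sup>2" by (simp add: cutoff_def)
qed

lemma square_le_cutoff:
  assumes "4 \<le> t"
  shows "t\<^sup>2 \<le> 2 ^ Suc m * cutoff m t"
proof -
  have "1 \<le> (2 * (1 - 2 / t)) ^ Suc m"
    using assms by (intro one_le_power) (simp add: field_simps)
  then have "t\<^sup>2 * 1 \<le> t\<^sup>2 * (2 * (1 - 2 / t)) ^ Suc m" by (intro mult_left_mono) auto
  also have "\<dots> = 2 ^ Suc m * cutoff m t"
    using assms unfolding power_mult_distrib by (simp add: cutoff_def)
  finally show ?thesis by simp
qed

text \<open>At the gluing point \<open>t = 2\<close> the cutoff is bounded by \<open>(t - 2)\<^sup>2\<close>, so both one-sided derivatives vanish.\<close>

lemma cutoff_has_derivative:
  assumes "1 \<le> m"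
  shows "(cutoff m has_real_derivative cutoff_deriv m t) (at t)"
proof (cases t "2 :: real" rule: linorder_cases)
  case less
  have "((\<lambda>_. 0) has_real_derivative cutoff_deriv m t) (at t)"
    using less by (simp add: cutoff_deriv_def)
  then show ?thesis
    by (rule has_field_derivative_transform_within_open[where S = "{..<2}"])
      (use less in \<open>auto simp: cutoff_def\<close>)
next
  case greater
  have "((\<lambda>t. t\<^sup>2 * (1 - 2 / t) ^ Suc m) has_real_derivative
      2 * t * (1 - 2 / t) ^ Suc m + t\<^sup>2 * (Suc m * (1 - 2 / t) ^ m * (2 / t\<^sup>2))) (at t)"
    using greater
    by (auto intro!: derivative_eq_intros simp del: power_Suc simp: power2_eq_square)
  also have "t\<^sup>2 * (Suc m * (1 - 2 / t) ^ m * (2 / t\<^sup>2)) = 2 * Suc m * (1 - 2 / t) ^ m"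
    using greater by (simp add: field_simps)
  finally have "((\<lambda>t. t\<^sup>2 * (1 - 2 / t) ^ Suc m) has_real_derivative cutoff_deriv m t) (at t)"
    using greater by (simp add: cutoff_deriv_def)
  then show ?thesis
    by (rule has_field_derivative_transform_within_open[where S = "{2<..}"])
      (use greater in \<open>auto simp: cutoff_def\<close>)
next
  case equal
  have le: "norm ((cutoff m (2 + h) - cutoff m 2) / h) \<le> \<bar>h\<bar>" for h
  proof (cases "h \<le> 0")
    case False
    then have "h > 0" by simp
    have "(1 - 2 / (2 + h)) ^ Suc m \<le> (1 - 2 / (2 + h)) ^ 2"
      using assms \<open>h > 0\<close> by (intro power_decreasing) auto
    then have "cutoff m (2 + h) \<le> (2 + h)\<^sup>2 * (1 - 2 / (2 + h))\<^sup>2"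
      using \<open>h > 0\<close> by (simp add: cutoff_def mult_left_mono)
    also have "\<dots> = ((2 + h) * (1 - 2 / (2 + h)))\<^sup>2" by (simp add: power_mult_distrib)
    also have "(2 + h) * (1 - 2 / (2 + h)) = h" using \<open>h > 0\<close> by (simp add: field_simps)
    finally show ?thesis
      using cutoff_le_square(1)[of m "2 + h"] \<open>h > 0\<close>
      by (simp add: cutoff_def[of m 2] field_simps power2_eq_square)
  qed (simp add: cutoff_def)
  have "((\<lambda>h. \<bar>h\<bar> :: real) \<longlongrightarrow> 0) (at 0)" by (intro tendsto_eq_intros) auto
  then have "(cutoff m has_real_derivative 0) (at 2)"
    unfolding DERIV_def by (rule Lim_null_comparison[rotated]) (use le in \<open>auto intro: always_eventually\<close>)
  then show ?thesis using equal by (simp add: cutoff_deriv_def)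
qed

lemma cutoff_deriv_bound:
  assumes "2 < t"
  shows "0 \<le> cutoff_deriv m t" "t * cutoff_deriv m t \<le> (real m + 3) * t\<^sup>2 * (1 - 2 / t) ^ m"
proof -
  define p where "p = 1 - 2 / t"
  have p: "0 \<le> p" "p \<le> 1" using assms by (auto simp: p_def)
  show "0 \<le> cutoff_deriv m t"
    using assms p by (auto simp: cutoff_deriv_def p_def[symmetric])
  have "t * cutoff_deriv m t = p ^ m * (2 * t\<^sup>2 * p + 2 * t * (real m + 1))"
    using assms by (simp add: cutoff_deriv_def p_def[symmetric] algebra_simps power2_eq_square)
  also have "\<dots> \<le> p ^ m * ((real m + 3) * t\<^sup>2)"
  proof (intro mult_left_mono)
    have "t\<^sup>2 * p \<le> t\<^sup>2 * 1" using p by (intro mult_left_mono) auto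
    moreover have "2 * t * (real m + 1) \<le> t * t * (real m + 1)"
      using assms by (intro mult_right_mono) auto
    ultimately show "2 * t\<^sup>2 * p + 2 * t * (real m + 1) \<le> (real m + 3) * t\<^sup>2"
      by (simp add: algebra_simps power2_eq_square)
  qed (use p in simp)
  finally show "t * cutoff_deriv m t \<le> (real m + 3) * t\<^sup>2 * (1 - 2 / t) ^ m"
    by (simp add: p_def mult_ac)
qed

lemma cutoff_deriv_bounded_on_bounded: "\<exists>L. \<forall>t. \<bar>t\<bar> \<le> r \<longrightarrow> \<bar>cutoff_deriv m t\<bar> \<le> L"
proof (intro exI allI impI)
  fix t assume "\<bar>t\<bar> \<le> r"
  show "\<bar>cutoff_deriv m t\<bar> \<le> (real m + 3) * \<bar>r\<bar>"
  proof (cases "2 < t")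
    case True
    have "t * cutoff_deriv m t \<le> (real m + 3) * t\<^sup>2 * (1 - 2 / t) ^ m"
      by (rule cutoff_deriv_bound(2)[OF True])
    also have "\<dots> \<le> (real m + 3) * t\<^sup>2 * 1"
      using True by (intro mult_left_mono power_le_one) auto
    also have "\<dots> = t * ((real m + 3) * t)" by (simp add: power2_eq_square)
    finally have "cutoff_deriv m t \<le> (real m + 3) * t" using True by simp
    also have "\<dots> \<le> (real m + 3) * \<bar>r\<bar>" using \<open>\<bar>t\<bar> \<le> r\<close> by (intro mult_left_mono) auto
    finally show ?thesis using cutoff_deriv_bound(1)[OF True, of m] by simp
  qed (simp add: cutoff_deriv_def)
qed

lemma cutoff_measurable [measurable]:
  "cutoff m \<in> borel_measurable borel" "cutoff_deriv m \<in> borel_measurable borel"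
  unfolding cutoff_def cutoff_deriv_def by measurable

section \<open>Estimates for a truncated function\<close>

text \<open>Here \<open>h\<close> is the cost function, \<open>g\<close> a Borel version of \<open>f'\<close>, and \<open>m\<close> the exponent of the cutoff. The constants
  of the estimates below are definitions in which \<open>f\<close>, \<open>g\<close> and \<open>h\<close> do not occur, so that the final bound is visibly
  uniform in \<open>f\<close>.\<close>

locale truncated_function = growth_potential +
  fixes m :: nat and C\<^sub>H C\<^sub>d :: real and h f g :: "real \<Rightarrow> real"
  assumes m: "1 \<le> m" "1 \<le> real m * \<epsilon>"
    and h_meas [measurable]: "h \<in> borel_measurable borel"
    and h_nonneg: "0 \<le> h s" and h_linear: "\<bar>s\<bar> \<le> 1 + h s"
    and h_young: "(real m + 3) * \<bar>s\<bar> * \<bar>y\<bar> \<le> \<Psi> y + h s + C\<^sub>H"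
    and C\<^sub>H: "0 \<le> C\<^sub>H" and C\<^sub>d: "0 \<le> C\<^sub>d" "\<bar>deriv \<Phi> x\<bar> \<le> C\<^sub>d * (1 + \<Psi> x)"
    and f_ac: "locally_abs_continuous f" and f_nonneg: "0 \<le> f x"
    and g_meas [measurable]: "g \<in> borel_measurable borel"
    and f_deriv: "AE x in lborel. (f has_real_derivative g x) (at x)"
begin

abbreviation w :: "real \<Rightarrow> real" where "w x \<equiv> exp (- \<Phi> x)"
abbreviation G :: "real \<Rightarrow> real" where "G x \<equiv> cutoff m (f x)"

text \<open>The quantity that pays for everything: mass and energy of the part of \<open>f\<close> above level \<open>2\<close>, before
  normalization of the measure.\<close>

definition q :: "real \<Rightarrow> real" where
  "q x = (if 2 \<le> f x then (f x)\<^sup>2 * (1 + h (g x / f x)) * w x else 0)"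

definition C_virial :: real where
  "C_virial = 1 + (2 * \<bar>\<Phi> 0\<bar> + \<Psi> M) + C\<^sub>H + (1 + \<epsilon>) * (\<bar>\<Phi> 0\<bar> + \<Psi> M)"

definition C_osc :: real where
  "C_osc = real m + 4 + C\<^sub>d"

lemma f_cont: "continuous_on UNIV f"
  by (rule locally_abs_continuous_imp_continuous[OF f_ac])

lemma G_cont: "continuous_on UNIV G"
proof -
  have "continuous_on UNIV (cutoff m)"
    using cutoff_has_derivative[OF m(1)] DERIV_continuous continuous_at_imp_continuous_on by blast
  then show ?thesis using continuous_on_compose2 f_cont by blast
qed

lemma f_meas [measurable]: "f \<in> borel_measurable borel"
  using f_cont by (rule borel_measurable_continuous_onI)

lemma Phi_meas [measurable]: "\<Phi> \<in> borel_measurable borel"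
  using Phi_continuous by (rule borel_measurable_continuous_onI)

lemma Psi_meas [measurable]: "\<Psi> \<in> borel_measurable borel"
  unfolding \<Psi>_def[abs_def] by measurable

lemma q_nonneg: "0 \<le> q x"
  by (simp add: q_def h_nonneg)

lemma C_virial_ge: "1 \<le> C_virial"
  using C\<^sub>H Psi_nonneg[of M] eps_pos by (simp add: C_virial_def)

lemma FTC_weighted:
  assumes "\<And>x. (\<theta> has_real_derivative \<theta>' x) (at x)" "continuous_on UNIV \<theta>'" "a \<le> b"
  shows "((\<lambda>x. cutoff_deriv m (f x) * g x * (\<theta> x * w x)
            + G x * ((\<theta>' x - \<theta> x * deriv \<Phi> x) * w x)) has_integral
          (G b * (\<theta> b * w b) - G a * (\<theta> a * w a))) {a..b}"
proof (rule FTC_composed_times_smooth[OF f_ac f_deriv cutoff_has_derivative[OF m(1)]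
        cutoff_deriv_bounded_on_bounded _ _ assms(3)])
  show "((\<lambda>x. \<theta> x * w x) has_real_derivative (\<theta>' x - \<theta> x * deriv \<Phi> x) * w x) (at x)" for x
    by (auto intro!: derivative_eq_intros assms(1) has_deriv simp: algebra_simps)
  have "continuous_on UNIV \<theta>"
    using assms(1) DERIV_continuous continuous_at_imp_continuous_on by blast
  then show "continuous_on UNIV (\<lambda>x. (\<theta>' x - \<theta> x * deriv \<Phi> x) * w x)"
    by (intro continuous_intros assms(2) deriv_cont Phi_continuous)
qed

text \<open>The left-hand side is the derivative of \<open>y G(y) exp (- \<Phi> y)\<close>. The term with \<open>f'\<close> equals \<open>t G'(t) s y\<close> with
  \<open>t = f y\<close>, and \<open>t G'(t) \<le> (m + 3) t\<^sup>2 p\<^sup>m\<close> for the ratio \<open>p = 1 - 2/t\<close>. Young's inequality for the factors \<open>p\<^sup>m y\<close> and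
  \<open>(m + 3) s\<close>, followed by \<open>Psi_scaling\<close>, yields \<open>t\<^sup>2 p\<^bsup>m + 1\<^esup> \<Psi> y\<close>, which is exactly \<open>G \<Psi>\<close>.\<close>

lemma virial_pointwise:
  "cutoff_deriv m (f y) * g y * (y * w y) + G y * ((1 - y * deriv \<Phi> y) * w y)
     \<le> C_virial * q y - \<epsilon> * (G y * \<Psi> y * w y)"
proof (cases "f y \<le> 2")
  case True
  then show ?thesis
    using q_nonneg[of y] C_virial_ge by (simp add: cutoff_def cutoff_deriv_def)
next
  case False
  define t s p where "t = f y" and "s = g y / f y" and "p = 1 - 2 / f y"
  have t: "t > 2" and p: "0 < p" "p < 1" using False by (auto simp: t_def p_def)
  have G: "G y = t\<^sup>2 * (p ^ m * p)" using t by (simp add: cutoff_def t_def p_def)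
  have G': "0 \<le> G y" "G y \<le> t\<^sup>2" unfolding t_def by (rule cutoff_le_square)+
  define C0 where "C0 = 2 * \<bar>\<Phi> 0\<bar> + \<Psi> M"
  define C0' where "C0' = (1 + \<epsilon>) * (\<bar>\<Phi> 0\<bar> + \<Psi> M)"
  have C0: "0 \<le> C0" "0 \<le> C0'" "C_virial = 1 + C0 + C\<^sub>H + C0'"
    using Psi_nonneg[of M] eps_pos by (auto simp: C0_def C0'_def C_virial_def)
  \<comment> \<open>this is where \<open>m \<epsilon> \<ge> 1\<close> is used\<close>
  have pm: "(p ^ m) powr (1 + \<epsilon>) \<le> p ^ m * p"
  proof -
    have "(p ^ m) powr (1 + \<epsilon>) = p ^ m * p powr (real m * \<epsilon>)"
      using p by (simp add: powr_add powr_realpow[symmetric] powr_powr)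
    also have "\<dots> \<le> p ^ m * p powr 1"
      using p m by (intro mult_left_mono powr_mono') auto
    finally show ?thesis using p by simp
  qed
  have "\<Psi> (p ^ m * y) \<le> (p ^ m) powr (1 + \<epsilon>) * \<Psi> y + C0"
    unfolding C0_def using p by (intro Psi_scaling power_le_one) auto
  also have "\<dots> \<le> p ^ m * p * \<Psi> y + C0"
    using pm Psi_nonneg by (intro add_right_mono mult_right_mono) auto
  finally have scal: "\<Psi> (p ^ m * y) \<le> p ^ m * p * \<Psi> y + C0" .
  have "cutoff_deriv m (f y) * g y * y \<le> \<bar>cutoff_deriv m (f y) * g y * y\<bar>" by simp
  also have "\<dots> = (t * cutoff_deriv m t) * \<bar>s\<bar> * \<bar>y\<bar>"
    using t cutoff_deriv_bound(1)[OF t, of m] by (simp add: abs_mult t_def s_def)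
  also have "\<dots> \<le> ((real m + 3) * t\<^sup>2 * p ^ m) * \<bar>s\<bar> * \<bar>y\<bar>"
    using cutoff_deriv_bound(2)[OF t, of m] by (intro mult_right_mono) (auto simp: p_def t_def)
  also have "\<dots> = t\<^sup>2 * ((real m + 3) * \<bar>s\<bar> * \<bar>p ^ m * y\<bar>)"
    using p by (simp add: abs_mult mult_ac)
  also have "\<dots> \<le> t\<^sup>2 * (\<Psi> (p ^ m * y) + h s + C\<^sub>H)"
    by (intro mult_left_mono h_young) auto
  also have "\<dots> \<le> t\<^sup>2 * ((p ^ m * p * \<Psi> y + C0) + h s + C\<^sub>H)"
    using scal by (intro mult_left_mono) auto
  also have "\<dots> = G y * \<Psi> y + t\<^sup>2 * (C0 + h s + C\<^sub>H)"
    unfolding G by (simp add: algebra_simps)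
  finally have 1: "cutoff_deriv m (f y) * g y * y \<le> G y * \<Psi> y + t\<^sup>2 * (C0 + h s + C\<^sub>H)" .
  have "G y * (1 - y * deriv \<Phi> y) \<le> G y * (1 - ((1 + \<epsilon>) * \<Psi> y - C0'))"
    using virial_lower_bound[of y] G' unfolding C0'_def by (intro mult_left_mono) auto
  also have "\<dots> = G y * (1 + C0') - (1 + \<epsilon>) * (G y * \<Psi> y)" by (simp add: algebra_simps)
  also have "\<dots> \<le> t\<^sup>2 * (1 + C0') - (1 + \<epsilon>) * (G y * \<Psi> y)"
    using G' C0 by (intro diff_right_mono mult_right_mono) auto
  finally have 2: "G y * (1 - y * deriv \<Phi> y) \<le> t\<^sup>2 * (1 + C0') - (1 + \<epsilon>) * (G y * \<Psi> y)" .
  have "t\<^sup>2 * (C0 + h s + C\<^sub>H) + t\<^sup>2 * (1 + C0') = t\<^sup>2 * (C_virial + h s)"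
    by (simp add: C0(3) algebra_simps)
  also have "\<dots> \<le> t\<^sup>2 * (C_virial * (1 + h s))"
    using C_virial_ge h_nonneg[of s] mult_right_mono[of 1 C_virial "h s"]
    by (intro mult_left_mono) (auto simp: distrib_left)
  finally have 3: "t\<^sup>2 * (C0 + h s + C\<^sub>H) + t\<^sup>2 * (1 + C0') \<le> t\<^sup>2 * (C_virial * (1 + h s))" .
  have "cutoff_deriv m (f y) * g y * y + G y * (1 - y * deriv \<Phi> y)
      \<le> t\<^sup>2 * (C_virial * (1 + h s)) - \<epsilon> * (G y * \<Psi> y)"
    using 1 2 3 by (simp add: distrib_right)
  then have "(cutoff_deriv m (f y) * g y * y + G y * (1 - y * deriv \<Phi> y)) * w y
      \<le> (t\<^sup>2 * (C_virial * (1 + h s)) - \<epsilon> * (G y * \<Psi> y)) * w y"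
    by (intro mult_right_mono) auto
  then show ?thesis
    using False by (simp add: q_def t_def s_def algebra_simps)
qed

text \<open>The left-hand side is the negative of the derivative of \<open>(x + 1 - y) G(y) exp (- \<Phi> y)\<close>. No absorption is
  needed here, so crude bounds on the cutoff suffice.\<close>

lemma oscillation_pointwise:
  assumes "x \<le> y" "y \<le> x + 1"
  shows "- (cutoff_deriv m (f y) * g y * ((x + 1 - y) * w y)
            + G y * ((- 1 - (x + 1 - y) * deriv \<Phi> y) * w y))
     \<le> C_osc * q y + C\<^sub>d * (G y * \<Psi> y * w y)"
proof (cases "f y \<le> 2")
  case True
  then show ?thesis
    using q_nonneg[of y] C\<^sub>d by (simp add: cutoff_def cutoff_deriv_def C_osc_def)
next
  case False
  define t s r where "t = f y" and "s = g y / f y" and "r = x + 1 - y"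
  have t: "t > 2" and r: "0 \<le> r" "r \<le> 1" using False assms by (auto simp: t_def r_def)
  have G: "0 \<le> G y" "G y \<le> t\<^sup>2" unfolding t_def by (rule cutoff_le_square)+
  have "- (cutoff_deriv m (f y) * g y * r) \<le> \<bar>cutoff_deriv m (f y) * g y * r\<bar>" by simp
  also have "\<dots> = (t * cutoff_deriv m t) * \<bar>s\<bar> * r"
    using t r cutoff_deriv_bound(1)[OF t, of m] by (simp add: abs_mult t_def s_def)
  also have "\<dots> \<le> (t * cutoff_deriv m t) * \<bar>s\<bar> * 1"
    using cutoff_deriv_bound(1)[OF t, of m] r t by (intro mult_left_mono) auto
  also have "\<dots> \<le> ((real m + 3) * t\<^sup>2 * (1 - 2 / t) ^ m) * \<bar>s\<bar> * 1"
    by (intro mult_right_mono cutoff_deriv_bound(2)[OF t]) auto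
  also have "\<dots> \<le> ((real m + 3) * t\<^sup>2 * 1) * \<bar>s\<bar> * 1"
    using t by (intro mult_right_mono mult_left_mono power_le_one) auto
  also have "\<dots> \<le> (real m + 3) * t\<^sup>2 * (1 + h s)"
    using mult_left_mono[OF h_linear[of s], of "(real m + 3) * t\<^sup>2"] by simp
  finally have 1: "- (cutoff_deriv m (f y) * g y * r) \<le> (real m + 3) * t\<^sup>2 * (1 + h s)" .
  have "r * deriv \<Phi> y \<le> 1 * \<bar>deriv \<Phi> y\<bar>"
    using mult_left_mono[OF abs_ge_self[of "deriv \<Phi> y"] r(1)]
      mult_right_mono[OF r(2) abs_ge_zero[of "deriv \<Phi> y"]] by linarith
  then have "r * deriv \<Phi> y \<le> C\<^sub>d * (1 + \<Psi> y)" using C\<^sub>d(2)[of y] by simp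
  then have "G y * (1 + r * deriv \<Phi> y) \<le> G y * (1 + C\<^sub>d * (1 + \<Psi> y))"
    using G by (intro mult_left_mono) auto
  also have "\<dots> = G y * (1 + C\<^sub>d) + C\<^sub>d * (G y * \<Psi> y)" by (simp add: algebra_simps)
  also have "\<dots> \<le> t\<^sup>2 * (1 + C\<^sub>d) + C\<^sub>d * (G y * \<Psi> y)"
    using G C\<^sub>d by (intro add_right_mono mult_right_mono) auto
  also have "\<dots> \<le> t\<^sup>2 * (1 + C\<^sub>d) * (1 + h s) + C\<^sub>d * (G y * \<Psi> y)"
    using h_nonneg[of s] C\<^sub>d mult_left_mono[of 1 "1 + h s" "t\<^sup>2 * (1 + C\<^sub>d)"] by simp
  finally have 2: "G y * (1 + r * deriv \<Phi> y)
      \<le> t\<^sup>2 * (1 + C\<^sub>d) * (1 + h s) + C\<^sub>d * (G y * \<Psi> y)" .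
  have "- (cutoff_deriv m (f y) * g y * r) + G y * (1 + r * deriv \<Phi> y)
      \<le> (real m + 3) * t\<^sup>2 * (1 + h s) + (t\<^sup>2 * (1 + C\<^sub>d) * (1 + h s) + C\<^sub>d * (G y * \<Psi> y))"
    using 1 2 by (rule add_mono)
  also have "\<dots> = C_osc * (t\<^sup>2 * (1 + h s)) + C\<^sub>d * (G y * \<Psi> y)"
    by (simp add: C_osc_def algebra_simps)
  finally have "(- (cutoff_deriv m (f y) * g y * r) + G y * (1 + r * deriv \<Phi> y)) * w y
      \<le> (C_osc * (t\<^sup>2 * (1 + h s)) + C\<^sub>d * (G y * \<Psi> y)) * w y"
    by (intro mult_right_mono) auto
  then show ?thesis
    using False unfolding r_def[symmetric] by (simp add: q_def t_def s_def algebra_simps)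
qed

definition Q :: real where
  "Q = (\<integral>x. q x \<partial>lborel)"

lemma integral_q_le:
  assumes "integrable lborel q"
  shows "q integrable_on {a..b}" "integral {a..b} q \<le> Q" "0 \<le> Q"
proof -
  have q: "(q has_integral Q) UNIV"
    unfolding Q_def by (rule has_integral_integral_lborel[OF assms])
  then show int: "q integrable_on {a..b}"
    using integrable_on_subinterval[of q UNIV a b] by blast
  have "integral {a..b} q \<le> integral UNIV q"
    using q int q_nonneg by (intro integral_subset_le) auto
  then show "integral {a..b} q \<le> Q" using q by (simp add: integral_unique)
  show "0 \<le> Q" unfolding Q_def by (intro integral_nonneg_AE) (simp add: q_nonneg)
qed

text \<open>The boundary term \<open>y G(y) exp (- \<Phi> y)\<close> is nonnegative at \<open>r\<close> and nonpositive at \<open>- r\<close>, so it can be dropped.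
  On the bounded interval \<open>\<integral>G \<Psi> exp (- \<Phi>)\<close> is finite, so it may be subtracted; only then \<open>r\<close> tends to infinity.\<close>

lemma potential_energy_bound:
  assumes q: "integrable lborel q"
  shows "integrable lborel (\<lambda>x. G x * \<Psi> x * w x)"
    "(\<integral>x. G x * \<Psi> x * w x \<partial>lborel) \<le> C_virial * Q / \<epsilon>"
proof -
  let ?u = "\<lambda>x. G x * \<Psi> x * w x"
  have u_cont: "continuous_on UNIV ?u"
    unfolding \<Psi>_def by (intro continuous_intros G_cont Phi_continuous)
  have bound: "\<exists>I \<le> C_virial * Q / \<epsilon>. (?u has_integral I) {-r..r}" if "0 \<le> r" for r
  proof -
    let ?S = "{-r..r}"
    have u: "?u integrable_on ?S"
      using u_cont continuous_on_subset by (intro integrable_continuous_interval) auto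
    let ?P = "G r * (r * w r) - G (- r) * (- r * w (- r))"
    have ftc: "((\<lambda>y. cutoff_deriv m (f y) * g y * (y * w y) + G y * ((1 - y * deriv \<Phi> y) * w y))
        has_integral ?P) ?S"
      using that by (intro FTC_weighted) (auto intro!: derivative_eq_intros)
    have "((\<lambda>y. C_virial * q y - \<epsilon> * ?u y) has_integral (C_virial * integral ?S q - \<epsilon> * integral ?S ?u)) ?S"
      using integral_q_le(1)[OF q] u
      by (intro has_integral_diff has_integral_mult_right integrable_integral)
    from has_integral_le[OF ftc this virial_pointwise]
    have "?P \<le> C_virial * integral ?S q - \<epsilon> * integral ?S ?u" by simp
    moreover have "0 \<le> ?P" using that by (simp add: cutoff_le_square(1))
    moreover have "C_virial * integral ?S q \<le> C_virial * Q"
      using integral_q_le(2)[OF q] C_virial_ge by (intro mult_left_mono) auto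
    ultimately have "\<epsilon> * integral ?S ?u \<le> C_virial * Q" by linarith
    then have "integral ?S ?u \<le> C_virial * Q / \<epsilon>" using eps_pos by (simp add: field_simps)
    then show ?thesis using u by (intro exI[of _ "integral ?S ?u"]) (auto intro: integrable_integral)
  qed
  have nonneg: "0 \<le> ?u x" for x
    using cutoff_le_square(1)[of m "f x"] Psi_nonneg[of x] by simp
  have "?u \<in> borel_measurable borel" by measurable
  note integrable_if_bounded_on_balls[OF this nonneg bound[OF of_nat_0_le_iff]]
  then show "integrable lborel ?u" "(\<integral>x. ?u x \<partial>lborel) \<le> C_virial * Q / \<epsilon>" by auto
qed

definition C_sup :: real where
  "C_sup = C_osc + C\<^sub>d * C_virial / \<epsilon>"

text \<open>The weight \<open>x + 1 - y\<close> is \<open>1\<close> at \<open>x\<close> and \<open>0\<close> at \<open>x + 1\<close>, so the boundary term is \<open>G(x) exp (- \<Phi> x)\<close> alone and no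
  decay at infinity has to be known.\<close>

lemma weighted_sup_bound:
  assumes q: "integrable lborel q"
  shows "G x * w x \<le> C_sup * Q"
proof -
  let ?u = "\<lambda>x. G x * \<Psi> x * w x"
  let ?S = "{x..x + 1}"
  let ?\<theta> = "\<lambda>y. x + 1 - y"
  note u = potential_energy_bound[OF q]
  have uU: "(?u has_integral (\<integral>x. ?u x \<partial>lborel)) UNIV"
    by (rule has_integral_integral_lborel[OF u(1)])
  then have uS: "?u integrable_on ?S"
    using integrable_on_subinterval[of ?u UNIV x "x + 1"] by blast
  have "integral ?S ?u \<le> integral UNIV ?u"
    using uU uS cutoff_le_square(1) Psi_nonneg by (intro integral_subset_le) auto
  also have "\<dots> \<le> C_virial * Q / \<epsilon>" using u(2) uU by (simp add: integral_unique)
  finally have u_le: "integral ?S ?u \<le> C_virial * Q / \<epsilon>" .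
  have "((\<lambda>y. cutoff_deriv m (f y) * g y * (?\<theta> y * w y)
        + G y * ((- 1 - ?\<theta> y * deriv \<Phi> y) * w y))
      has_integral (G (x + 1) * (?\<theta> (x + 1) * w (x + 1)) - G x * (?\<theta> x * w x))) ?S"
    by (rule FTC_weighted) (auto intro!: derivative_eq_intros)
  from has_integral_neg[OF this]
  have ftc: "((\<lambda>y. - (cutoff_deriv m (f y) * g y * (?\<theta> y * w y)
        + G y * ((- 1 - ?\<theta> y * deriv \<Phi> y) * w y))) has_integral G x * w x) ?S"
    by simp
  have "((\<lambda>y. C_osc * q y + C\<^sub>d * ?u y) has_integral (C_osc * integral ?S q + C\<^sub>d * integral ?S ?u)) ?S"
    using integral_q_le(1)[OF q] uS
    by (intro has_integral_add has_integral_mult_right integrable_integral)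
  from has_integral_le[OF ftc this] oscillation_pointwise
  have "G x * w x \<le> C_osc * integral ?S q + C\<^sub>d * integral ?S ?u" by auto
  also have "\<dots> \<le> C_osc * Q + C\<^sub>d * (C_virial * Q / \<epsilon>)"
    using integral_q_le(2)[OF q] u_le C\<^sub>d by (intro add_mono mult_left_mono) (auto simp: C_osc_def)
  also have "\<dots> = C_sup * Q" by (simp add: C_sup_def algebra_simps)
  finally show ?thesis .
qed

definition C_ent :: "real \<Rightarrow> real" where
  "C_ent Z = (2 ^ Suc m)\<^sup>2 * exp (\<Phi> 0) * C_sup * Z + 2 ^ Suc m * C_virial / \<epsilon>"

text \<open>The logarithm splits as \<open>ln t\<^sup>2 = ln (t\<^sup>2 exp (- \<Psi>)) + \<Psi>\<close>. The first part is linearized by \<open>ln u \<le> u\<close> and then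
  bounded by \<open>weighted_sup_bound\<close>; the second is the potential energy.\<close>

lemma truncated_entropy_bound:
  assumes q: "integrable lborel q"
    and f2: "integrable lborel (\<lambda>x. (f x)\<^sup>2 * w x)" "(\<integral>x. (f x)\<^sup>2 * w x \<partial>lborel) = Z"
  defines "W \<equiv> \<lambda>x. if 4 \<le> f x then (f x)\<^sup>2 * ln ((f x)\<^sup>2) * w x else 0"
  shows "integrable lborel W" "(\<integral>x. W x \<partial>lborel) \<le> C_ent Z * Q"
proof -
  define c :: real where "c = 2 ^ Suc m"
  have "1 \<le> c" unfolding c_def by (rule one_le_power) simp
  have "0 \<le> Q" using integral_q_le(3)[OF q] .
  have "0 \<le> C_sup"
    using C\<^sub>d C_virial_ge eps_pos by (auto simp: C_sup_def C_osc_def)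
  let ?u = "\<lambda>x. G x * \<Psi> x * w x"
  define S where "S = c\<^sup>2 * exp (\<Phi> 0) * (C_sup * Q)"
  have "0 \<le> S" using \<open>0 \<le> Q\<close> \<open>0 \<le> C_sup\<close> by (simp add: S_def)
  have W_nonneg: "0 \<le> W x" for x
  proof -
    have "0 \<le> ln ((f x)\<^sup>2)" if "4 \<le> f x" using that by (intro ln_ge_zero one_le_power) auto
    then show ?thesis by (simp add: W_def)
  qed
  have W_le: "W x \<le> S * ((f x)\<^sup>2 * w x) + c * ?u x" for x
  proof (cases "4 \<le> f x")
    case False
    then show ?thesis
      using \<open>0 \<le> S\<close> \<open>1 \<le> c\<close> cutoff_le_square(1)[of m "f x"] Psi_nonneg[of x] by (simp add: W_def)
  next
    case True
    define t where "t = f x"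
    have "t > 0" using True by (simp add: t_def)
    have tG: "t\<^sup>2 \<le> c * G x" using square_le_cutoff[OF True, of m] by (simp add: c_def t_def)
    have G: "0 \<le> G x" "G x \<le> t\<^sup>2" unfolding t_def by (rule cutoff_le_square)+
    have "ln (t\<^sup>2) - \<Psi> x = ln (t\<^sup>2 * exp (- \<Psi> x))"
      using \<open>t > 0\<close> by (simp add: ln_mult)
    also have "\<dots> \<le> t\<^sup>2 * exp (- \<Psi> x)"
      using \<open>t > 0\<close> by (intro ln_bound) auto
    also have "\<dots> = t\<^sup>2 * (exp (\<Phi> 0) * w x)" by (simp add: \<Psi>_def exp_diff exp_minus field_simps)
    also have "\<dots> \<le> c * G x * (exp (\<Phi> 0) * w x)" using tG by (intro mult_right_mono) auto
    finally have "ln (t\<^sup>2) \<le> c * exp (\<Phi> 0) * (G x * w x) + \<Psi> x" by (simp add: mult_ac)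
    also have "\<dots> \<le> c * exp (\<Phi> 0) * (C_sup * Q) + \<Psi> x"
      using weighted_sup_bound[OF q, of x] \<open>1 \<le> c\<close> by (intro add_right_mono mult_left_mono) auto
    finally have ln_le: "ln (t\<^sup>2) \<le> c * exp (\<Phi> 0) * (C_sup * Q) + \<Psi> x" .
    have rhs0: "0 \<le> c * exp (\<Phi> 0) * (C_sup * Q) + \<Psi> x"
      using \<open>1 \<le> c\<close> \<open>0 \<le> C_sup\<close> \<open>0 \<le> Q\<close> Psi_nonneg[of x] by simp
    have "t\<^sup>2 * ln (t\<^sup>2) \<le> t\<^sup>2 * (c * exp (\<Phi> 0) * (C_sup * Q) + \<Psi> x)"
      using ln_le by (intro mult_left_mono) auto
    also have "\<dots> \<le> (c * G x) * (c * exp (\<Phi> 0) * (C_sup * Q) + \<Psi> x)"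
      using tG rhs0 by (rule mult_right_mono)
    also have "\<dots> = S * G x + c * (G x * \<Psi> x)"
      by (simp add: S_def algebra_simps power2_eq_square)
    also have "\<dots> \<le> S * t\<^sup>2 + c * (G x * \<Psi> x)"
      using G \<open>0 \<le> S\<close> by (intro add_right_mono mult_left_mono) auto
    finally have "t\<^sup>2 * ln (t\<^sup>2) * w x \<le> (S * t\<^sup>2 + c * (G x * \<Psi> x)) * w x"
      by (intro mult_right_mono) auto
    then show ?thesis using True by (simp add: W_def t_def algebra_simps)
  qed
  note u = potential_energy_bound[OF q]
  have R: "integrable lborel (\<lambda>x. S * ((f x)\<^sup>2 * w x) + c * ?u x)"
    using f2(1) u(1) by (intro Bochner_Integration.integrable_add integrable_mult_right)
  have W_meas: "W \<in> borel_measurable lborel" unfolding W_def by measurable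
  show W: "integrable lborel W"
  proof (rule Bochner_Integration.integrable_bound[OF R W_meas], rule AE_I2)
    fix x show "norm (W x) \<le> norm (S * ((f x)\<^sup>2 * w x) + c * ?u x)"
      using W_nonneg[of x] W_le[of x] by simp
  qed
  have "(\<integral>x. W x \<partial>lborel) \<le> (\<integral>x. S * ((f x)\<^sup>2 * w x) + c * ?u x \<partial>lborel)"
    by (rule integral_mono[OF W R W_le])
  also have "\<dots> = S * Z + c * (\<integral>x. ?u x \<partial>lborel)"
    using f2 u(1) by simp
  also have "\<dots> \<le> S * Z + c * (C_virial * Q / \<epsilon>)"
    using u(2) \<open>1 \<le> c\<close> by (intro add_left_mono mult_left_mono) auto
  also have "\<dots> = C_ent Z * Q"
    by (simp add: C_ent_def S_def c_def algebra_simps)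
  finally show "(\<integral>x. W x \<partial>lborel) \<le> C_ent Z * Q" .
qed

end

section \<open>Entropy with respect to the normalized measure\<close>

text \<open>For \<open>t < 4\<close> use \<open>ln t \<le> t - 1\<close> and \<open>2 t\<^sup>2 (t - 1) = (t\<^sup>2 - 1) + (2 t + 1) (t - 1)\<^sup>2\<close>.\<close>

lemma square_ln_le:
  fixes t :: real
  assumes "0 \<le> t"
  shows "t\<^sup>2 * ln (t\<^sup>2) \<le> (t\<^sup>2 - 1) + 9 * (t - 1)\<^sup>2 + (if 4 \<le> t then t\<^sup>2 * ln (t\<^sup>2) else 0)"
proof -
  consider "t = 0" | "0 < t" "t < 4" | "4 \<le> t" using assms by linarith
  then show ?thesis
  proof cases
    case 2
    have "t\<^sup>2 * ln (t\<^sup>2) = 2 * t\<^sup>2 * ln t" using 2 by (simp add: ln_realpow)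
    also have "\<dots> \<le> 2 * t\<^sup>2 * (t - 1)"
      using 2 ln_le_minus_one[of t] by (intro mult_left_mono) auto
    also have "\<dots> = (t\<^sup>2 - 1) + (2 * t + 1) * (t - 1)\<^sup>2"
      by (simp add: algebra_simps power2_eq_square)
    also have "\<dots> \<le> (t\<^sup>2 - 1) + 9 * (t - 1)\<^sup>2"
      using 2 by (intro add_left_mono mult_right_mono) auto
    finally show ?thesis using 2 by simp
  next
    case 3
    then have "1 \<le> t\<^sup>2" by (intro one_le_power) auto
    then show ?thesis using 3 by simp
  qed simp
qed

lemma square_ln_ge:
  fixes t :: real
  shows "-1 \<le> t\<^sup>2 * ln (t\<^sup>2)"
proof (cases "t = 0")
  case False
  then have "ln (1 / t\<^sup>2) \<le> 1 / t\<^sup>2 - 1" by (intro ln_le_minus_one) auto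
  then have "1 - 1 / t\<^sup>2 \<le> ln (t\<^sup>2)" using False by (simp add: ln_div)
  then have "t\<^sup>2 * (1 - 1 / t\<^sup>2) \<le> t\<^sup>2 * ln (t\<^sup>2)" by (intro mult_left_mono) auto
  moreover have "t\<^sup>2 * (1 - 1 / t\<^sup>2) = t\<^sup>2 - 1" using False by (simp add: field_simps)
  ultimately show ?thesis using zero_le_power2[of t] by linarith
qed simp

lemma ext_integral_ereal:
  assumes "integrable M u"
  shows "ext_integral M (\<lambda>x. ereal (u x)) = ereal (\<integral>x. u x \<partial>M)"
proof -
  have fin: "(\<integral>\<^sup>+ x. ennreal (u x) \<partial>M) \<noteq> \<infinity>" "(\<integral>\<^sup>+ x. ennreal (- u x) \<partial>M) \<noteq> \<infinity>"
    using assms by (auto simp: real_integrable_def)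
  have real: "enn2ereal a = ereal (enn2real a)" if "a \<noteq> \<infinity>" for a
    using that by (cases a) auto
  have "ext_integral M (\<lambda>x. ereal (u x))
      = enn2ereal (\<integral>\<^sup>+ x. ennreal (u x) \<partial>M) - enn2ereal (\<integral>\<^sup>+ x. ennreal (- u x) \<partial>M)"
    by (simp add: ext_integral_def e2ennreal_ereal)
  also have "\<dots> = ereal (\<integral>x. u x \<partial>M)"
    using fin assms by (simp add: real real_lebesgue_integral_def)
  finally show ?thesis .
qed

text \<open>The integrand \<open>k\<close> need not be measurable. This matters because the energy is written with \<^const>\<open>deriv\<close>,
  which agrees with a Borel function only almost everywhere.\<close>

lemma ext_integral_nonneg_cong:
  assumes "AE x in M. k x = ereal (u x)" "\<And>x. 0 \<le> u x"
  shows "ext_integral M k = enn2ereal (\<integral>\<^sup>+ x. ennreal (u x) \<partial>M)"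
proof -
  have "(\<integral>\<^sup>+ x. e2ennreal (k x) \<partial>M) = (\<integral>\<^sup>+ x. ennreal (u x) \<partial>M)"
    using assms(1) by (intro nn_integral_cong_AE) (auto simp: e2ennreal_ereal)
  moreover have "(\<integral>\<^sup>+ x. e2ennreal (- k x) \<partial>M) = (\<integral>\<^sup>+ x. 0 \<partial>M)"
    using assms by (intro nn_integral_cong_AE) (auto simp: e2ennreal_ereal ennreal_neg)
  ultimately show ?thesis by (simp add: ext_integral_def zero_ennreal.rep_eq)
qed

lemma mu_integral:
  assumes [measurable]: "\<Phi> \<in> borel_measurable borel" "u \<in> borel_measurable borel"
  shows "integrable (mu \<Phi>) u \<longleftrightarrow> integrable lborel (\<lambda>x. u x * exp (- \<Phi> x) / Z_const \<Phi>)"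
    "(\<integral>x. u x \<partial>mu \<Phi>) = (\<integral>x. u x * exp (- \<Phi> x) / Z_const \<Phi> \<partial>lborel)"
proof -
  have Z: "0 \<le> Z_const \<Phi>" unfolding Z_const_def by (intro integral_nonneg_AE) simp
  show "integrable (mu \<Phi>) u \<longleftrightarrow> integrable lborel (\<lambda>x. u x * exp (- \<Phi> x) / Z_const \<Phi>)"
    unfolding mu_def using Z by (subst integrable_density) (auto simp: mult.commute)
  show "(\<integral>x. u x \<partial>mu \<Phi>) = (\<integral>x. u x * exp (- \<Phi> x) / Z_const \<Phi> \<partial>lborel)"
    unfolding mu_def using Z by (subst integral_density) (auto simp: mult.commute)
qed

lemma mu_prob_space:
  assumes [measurable]: "\<Phi> \<in> borel_measurable borel" and Z: "Z_const \<Phi> \<noteq> 0"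
  shows "prob_space (mu \<Phi>)"
proof
  have int: "integrable lborel (\<lambda>x. exp (- \<Phi> x))"
    using Z not_integrable_integral_eq unfolding Z_const_def by blast
  have Z0: "0 \<le> Z_const \<Phi>" unfolding Z_const_def by (intro integral_nonneg_AE) simp
  have "emeasure (mu \<Phi>) (space (mu \<Phi>)) = (\<integral>\<^sup>+ x. ennreal (exp (- \<Phi> x) / Z_const \<Phi>) \<partial>lborel)"
    by (simp add: mu_def emeasure_density)
  also have "\<dots> = ennreal (\<integral>x. exp (- \<Phi> x) / Z_const \<Phi> \<partial>lborel)"
    using int Z0 by (intro nn_integral_eq_integral) auto
  also have "(\<integral>x. exp (- \<Phi> x) / Z_const \<Phi> \<partial>lborel) = 1"
    using Z by (simp add: Z_const_def)
  finally show "emeasure (mu \<Phi>) (space (mu \<Phi>)) = 1" by simp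
qed

context truncated_function
begin

text \<open>If the energy is infinite there is nothing to prove, as \<open>A' > 0\<close>. That \<open>Z\<close> is positive follows from the
  normalization of \<open>f\<close>: were the density not integrable, \<open>Z\<close> and with it the measure would vanish.\<close>

theorem modified_log_sobolev_truncated:
  assumes Z: "Z = Z_const \<Phi>" and norm: "(\<integral>x. (f x)\<^sup>2 \<partial>mu \<Phi>) = 1"
    and H: "\<And>s. H_fun \<Phi> B 1 s = ereal (h s)"
    and A: "18 + 8 * C_ent Z \<le> A" "C_ent Z + 1 \<le> A'"
  shows "Ent (mu \<Phi>) (\<lambda>x. (f x)\<^sup>2)
      \<le> ereal (A * Var (mu \<Phi>) f) + ereal A' * H_energy \<Phi> B 1 4 f"
proof -
  let ?M = "mu \<Phi>"
  note mu = mu_integral[OF Phi_meas]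
  define e where "e x = (if 2 \<le> f x then (f x)\<^sup>2 * h (g x / f x) else 0)" for x
  have e0: "0 \<le> e x" for x by (simp add: e_def h_nonneg)
  have [measurable]: "e \<in> borel_measurable borel" unfolding e_def[abs_def] by measurable
  have sets_M [measurable_cong]: "sets ?M = sets borel" by (simp add: mu_def)
  have Z0: "0 \<le> Z" unfolding Z Z_const_def by (intro integral_nonneg_AE) simp
  have "Z \<noteq> 0"
  proof
    assume "Z = 0"
    then have "(\<integral>x. (f x)\<^sup>2 \<partial>?M) = 0" using mu(2)[of "\<lambda>x. (f x)\<^sup>2"] Z by simp
    then show False using norm by simp
  qed
  then have Zp: "0 < Z" using Z0 by simp
  interpret M: prob_space ?M
    using mu_prob_space[OF Phi_meas] \<open>Z \<noteq> 0\<close> Z by blast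
  have f2: "integrable ?M (\<lambda>x. (f x)\<^sup>2)"
    using norm not_integrable_integral_eq by fastforce
  have f1: "integrable ?M f"
  proof (rule Bochner_Integration.integrable_bound[of ?M "\<lambda>x. 1 + (f x)\<^sup>2"])
    show "AE x in ?M. norm (f x) \<le> norm (1 + (f x)\<^sup>2)"
    proof (rule AE_I2)
      fix x
      have "0 \<le> (f x - 1)\<^sup>2" by simp
      then have "2 * f x \<le> 1 + (f x)\<^sup>2" by (simp add: power2_diff)
      then show "norm (f x) \<le> norm (1 + (f x)\<^sup>2)" using f_nonneg[of x] by simp
    qed
  qed (use f2 in simp_all)
  define m1 where "m1 = (\<integral>x. f x \<partial>?M)"
  define D where "D = (\<integral>x. (f x - 1)\<^sup>2 \<partial>?M)"
  have d: "integrable ?M (\<lambda>x. (f x - 1)\<^sup>2)"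
    using f1 f2 by (simp add: power2_diff)
  have D_eq: "D = 2 - 2 * m1"
    unfolding D_def m1_def power2_diff using f1 f2 norm by (simp add: M.prob_space)
  have "0 \<le> D" unfolding D_def by (intro integral_nonneg_AE) simp
  have "0 \<le> m1" unfolding m1_def using f_nonneg by (intro integral_nonneg_AE) simp
  have Var: "Var ?M f = 1 - m1\<^sup>2" by (simp add: Var_def norm m1_def)
  have D_le: "D \<le> 2 * Var ?M f"
  proof -
    have "m1 * m1 \<le> 1 * m1"
      using \<open>0 \<le> D\<close> D_eq \<open>0 \<le> m1\<close> by (intro mult_right_mono) auto
    then show ?thesis unfolding Var D_eq by (simp add: power2_eq_square)
  qed
  have energy: "H_energy \<Phi> B 1 4 f = enn2ereal (\<integral>\<^sup>+ x. ennreal (e x) \<partial>?M)"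
    unfolding H_energy_def
  proof (rule ext_integral_nonneg_cong[OF _ e0])
    have "AE x in lborel. deriv f x = g x"
      using f_deriv by eventually_elim (rule DERIV_imp_deriv)
    then have "AE x in ?M. deriv f x = g x"
      unfolding mu_def by (subst AE_density) auto
    then show "AE x in ?M. H_fun \<Phi> B 1 (deriv f x / f x) * ereal ((f x)\<^sup>2)
        * indicator {x. 4 \<le> (f x)\<^sup>2} x = ereal (e x)"
    proof eventually_elim
      case (elim x)
      have "4 \<le> (f x)\<^sup>2 \<longleftrightarrow> 2 \<le> f x"
        using f_nonneg[of x] power2_le_iff_abs_le[of "f x" 2] abs_le_square_iff[of 2 "f x"] by simp
      then show ?case by (simp add: elim H e_def indicator_def mult.commute)
    qed
  qed
  show ?thesis
  proof (cases "(\<integral>\<^sup>+ x. ennreal (e x) \<partial>?M) = \<infinity>")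
    case True
    have "0 \<le> C_ent Z"
      using C\<^sub>d C_virial_ge eps_pos Z0 by (auto simp: C_ent_def C_sup_def C_osc_def)
    then have "0 < A'" using A by simp
    then show ?thesis by (simp add: energy True)
  next
    case False
    have e: "integrable ?M e"
      using False e0 by (intro integrableI_nonneg) (auto simp: top.not_eq_extremum)
    define E where "E = (\<integral>x. e x \<partial>?M)"
    have "0 \<le> E" unfolding E_def using e0 by (intro integral_nonneg_AE) simp
    have energy: "H_energy \<Phi> B 1 4 f = ereal E"
      using nn_integral_eq_integral[OF e] e0 \<open>0 \<le> E\<close> by (simp add: energy E_def)
    define r where "r x = (if 2 \<le> f x then (f x)\<^sup>2 else 0)" for x
    have [measurable]: "r \<in> borel_measurable borel" unfolding r_def[abs_def] by measurable
    have r_le: "r x \<le> 4 * (f x - 1)\<^sup>2" for x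
    proof (cases "2 \<le> f x")
      case True
      then have "(f x)\<^sup>2 \<le> (2 * (f x - 1))\<^sup>2" by (intro power_mono) auto
      then have "(f x)\<^sup>2 \<le> 2\<^sup>2 * (f x - 1)\<^sup>2" unfolding power_mult_distrib .
      then show ?thesis using True by (simp add: r_def)
    qed (simp add: r_def)
    have r: "integrable ?M r"
      by (rule Bochner_Integration.integrable_bound[OF f2]) (auto simp: r_def)
    have "(\<integral>x. r x \<partial>?M) \<le> (\<integral>x. 4 * (f x - 1)\<^sup>2 \<partial>?M)"
      using r d by (intro integral_mono r_le) auto
    also have "\<dots> = 4 * D" by (simp add: D_def)
    finally have R_le: "(\<integral>x. r x \<partial>?M) \<le> 4 * D" .
    have q_eq: "q = (\<lambda>x. Z * ((r x + e x) * w x / Z_const \<Phi>))"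
    proof
      fix x
      have "q x = (r x + e x) * w x" by (simp add: q_def r_def e_def distrib_left)
      then show "q x = Z * ((r x + e x) * w x / Z_const \<Phi>)" using Zp by (simp add: Z)
    qed
    have re: "integrable lborel (\<lambda>x. (r x + e x) * w x / Z_const \<Phi>)"
      using r e by (subst mu(1)[symmetric]) auto
    have q: "integrable lborel q" unfolding q_eq using re by (rule integrable_mult_right)
    have Q: "Q = Z * ((\<integral>x. r x \<partial>?M) + E)"
    proof -
      have "Q = Z * (\<integral>x. (r x + e x) * w x / Z_const \<Phi> \<partial>lborel)"
        unfolding Q_def q_eq by (rule integral_mult_right_zero)
      also have "(\<integral>x. (r x + e x) * w x / Z_const \<Phi> \<partial>lborel) = (\<integral>x. r x + e x \<partial>?M)"
        by (rule mu(2)[symmetric]) simp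
      also have "\<dots> = (\<integral>x. r x \<partial>?M) + E" using r e by (simp add: E_def)
      finally show ?thesis .
    qed
    have f2_leb: "integrable lborel (\<lambda>x. (f x)\<^sup>2 * w x)" "(\<integral>x. (f x)\<^sup>2 * w x \<partial>lborel) = Z"
    proof -
      have eq: "(\<lambda>x. (f x)\<^sup>2 * w x) = (\<lambda>x. Z * ((f x)\<^sup>2 * w x / Z_const \<Phi>))"
        using Zp Z by auto
      have "integrable lborel (\<lambda>x. (f x)\<^sup>2 * w x / Z_const \<Phi>)"
        using f2 by (subst mu(1)[symmetric]) auto
      then show "integrable lborel (\<lambda>x. (f x)\<^sup>2 * w x)"
        unfolding eq by (rule integrable_mult_right)
      have "(\<integral>x. (f x)\<^sup>2 * w x \<partial>lborel) = Z * (\<integral>x. (f x)\<^sup>2 * w x / Z_const \<Phi> \<partial>lborel)"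
        unfolding eq by (rule integral_mult_right_zero)
      also have "\<dots> = Z * 1" using mu(2)[of "\<lambda>x. (f x)\<^sup>2"] norm by simp
      finally show "(\<integral>x. (f x)\<^sup>2 * w x \<partial>lborel) = Z" by simp
    qed
    define W where "W x = (if 4 \<le> f x then (f x)\<^sup>2 * ln ((f x)\<^sup>2) else 0)" for x
    have [measurable]: "W \<in> borel_measurable borel" unfolding W_def[abs_def] by measurable
    have W_eq: "(\<lambda>x. if 4 \<le> f x then (f x)\<^sup>2 * ln ((f x)\<^sup>2) * w x else 0) = (\<lambda>x. W x * w x)"
      by (auto simp: W_def)
    note W_leb = truncated_entropy_bound[OF q f2_leb, unfolded W_eq]
    have W: "integrable ?M W"
      using W_leb(1) by (subst mu(1)) auto
    have "(\<integral>x. W x \<partial>?M) = (\<integral>x. W x * w x \<partial>lborel) / Z"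
      by (subst mu(2)) (simp_all add: Z)
    also have "\<dots> \<le> C_ent Z * Q / Z" using W_leb(2) Zp by (intro divide_right_mono) auto
    also have "\<dots> = C_ent Z * ((\<integral>x. r x \<partial>?M) + E)" using Zp by (simp add: Q)
    finally have W_le: "(\<integral>x. W x \<partial>?M) \<le> C_ent Z * ((\<integral>x. r x \<partial>?M) + E)" .
    let ?u = "\<lambda>x. (f x)\<^sup>2 * ln ((f x)\<^sup>2)"
    let ?U = "\<lambda>x. ((f x)\<^sup>2 - 1) + 9 * (f x - 1)\<^sup>2 + W x"
    have u_le: "?u x \<le> ?U x" for x
      using square_ln_le[OF f_nonneg, of x] by (simp add: W_def)
    have U: "integrable ?M ?U" using f2 d W by simp
    have u: "integrable ?M ?u"
    proof (rule Bochner_Integration.integrable_bound)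
      show "integrable ?M (\<lambda>x. 1 + \<bar>?U x\<bar>)" using U by simp
      show "AE x in ?M. norm (?u x) \<le> norm (1 + \<bar>?U x\<bar>)"
      proof (rule AE_I2)
        fix x
        show "norm (?u x) \<le> norm (1 + \<bar>?U x\<bar>)"
          using u_le[of x] square_ln_ge[of "f x"] unfolding real_norm_def by linarith
      qed
    qed measurable
    have "Ent ?M (\<lambda>x. (f x)\<^sup>2) = ereal (\<integral>x. ?u x \<partial>?M)"
      using ext_integral_ereal[OF u] by (simp add: Ent_def norm)
    moreover have "(\<integral>x. ?u x \<partial>?M) \<le> A * Var ?M f + A' * E"
    proof -
      \<comment> \<open>\<open>9 (f - 1)\<^sup>2\<close> costs \<open>9 D \<le> 18 Var\<close>; the mass above level \<open>2\<close> costs \<open>4 D \<le> 8 Var\<close>, times the entropy constant\<close>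
      have C5: "0 \<le> C_ent Z"
        using C\<^sub>d C_virial_ge eps_pos Z0 by (auto simp: C_ent_def C_sup_def C_osc_def)
      have "(\<integral>x. ?u x \<partial>?M) \<le> (\<integral>x. ?U x \<partial>?M)"
        using u U u_le by (rule integral_mono)
      also have "\<dots> = 9 * D + (\<integral>x. W x \<partial>?M)"
        using f2 d W by (simp add: norm D_def M.prob_space)
      also have "\<dots> \<le> 9 * D + C_ent Z * (4 * D + E)"
        using W_le R_le mult_left_mono[OF R_le C5] by (simp add: distrib_left)
      also have "\<dots> = (9 + 4 * C_ent Z) * D + C_ent Z * E" by (simp add: algebra_simps)
      also have "\<dots> \<le> (9 + 4 * C_ent Z) * (2 * Var ?M f) + (C_ent Z + 1) * E"
        using D_le C5 \<open>0 \<le> E\<close> by (intro add_mono mult_left_mono mult_right_mono) auto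
      also have "\<dots> = (18 + 8 * C_ent Z) * Var ?M f + (C_ent Z + 1) * E" by (simp add: algebra_simps)
      also have "\<dots> \<le> A * Var ?M f + A' * E"
        using A \<open>0 \<le> E\<close> \<open>0 \<le> D\<close> D_le by (intro add_mono mult_right_mono) auto
      finally show ?thesis .
    qed
    ultimately show ?thesis by (simp add: energy)
  qed
qed

end

theorem theorem1p2:
  fixes \<Phi> :: "real \<Rightarrow> real"
  assumes "even_fun \<Phi>"
    and "convex_on UNIV \<Phi>"
    and "class_C2 \<Phi>"
    and "\<exists>M \<epsilon>. M > 0 \<and> 0 < \<epsilon> \<and> \<epsilon> \<le> 1 / 2 \<and> \<Phi> M > 0 \<and>
           (\<forall>x\<ge>M. (1 + \<epsilon>) * \<Phi> x \<le> x * deriv \<Phi> x \<and> x * deriv \<Phi> x \<le> (2 - \<epsilon>) * \<Phi> x)"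
  shows "\<exists>A A' B D \<kappa> :: real.
           A \<ge> 0 \<and> A' \<ge> 0 \<and> B \<ge> 0 \<and> D \<ge> 0 \<and> \<kappa> \<ge> 0 \<and>
           (\<forall>f :: real \<Rightarrow> real.
              locally_abs_continuous f \<longrightarrow> (\<forall>x. f x \<ge> 0) \<longrightarrow> (\<integral>x. (f x)\<^sup>2 \<partial>mu \<Phi>) = 1 \<longrightarrow>
              Ent (mu \<Phi>) (\<lambda>x. (f x)\<^sup>2)
                \<le> ereal (A * Var (mu \<Phi>) f) + ereal A' * H_energy \<Phi> B D \<kappa> f)"
proof -
  obtain M \<epsilon> where M: "M > 0" "0 < \<epsilon>" "\<Phi> M > 0"
    and growth: "\<And>x. x \<ge> M \<Longrightarrow> (1 + \<epsilon>) * \<Phi> x \<le> x * deriv \<Phi> x"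
      "\<And>x. x \<ge> M \<Longrightarrow> x * deriv \<Phi> x \<le> (2 - \<epsilon>) * \<Phi> x"
    using assms(4) by blast
  interpret growth_potential \<Phi> M \<epsilon>
  proof
    show "\<Phi> (- x) = \<Phi> x" for x using assms(1) by (simp add: even_fun_def)
    show "(\<Phi> has_real_derivative deriv \<Phi> x) (at x)" for x
      using assms(3) by (simp add: class_C2_def DERIV_deriv_iff_real_differentiable)
    show "continuous_on UNIV (deriv \<Phi>)"
      using assms(3) unfolding class_C2_def
      by (intro continuous_at_imp_continuous_on ballI differentiable_imp_continuous_within) auto
  qed (use assms(2) M growth in auto)
  obtain m :: nat where m: "max 1 (1 / \<epsilon>) \<le> m" using real_arch_simple by blast
  then have m': "1 \<le> m" "1 \<le> real m * \<epsilon>" using M by (auto simp: field_simps)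
  obtain B C\<^sub>H h where h: "B \<ge> 0" "C\<^sub>H \<ge> 0" "h \<in> borel_measurable borel"
    "\<And>s. H_fun \<Phi> B 1 s = ereal (h s)" "\<And>s. 0 \<le> h s" "\<And>s. \<bar>s\<bar> \<le> 1 + h s"
    "\<And>s y. (real m + 3) * \<bar>s\<bar> * \<bar>y\<bar> \<le> \<Psi> y + h s + C\<^sub>H"
    using H_fun_real[of "real m + 3"] by auto
  obtain C\<^sub>d where C\<^sub>d: "C\<^sub>d \<ge> 0" "\<And>x. \<bar>deriv \<Phi> x\<bar> \<le> C\<^sub>d * (1 + \<Psi> x)"
    using deriv_bound by blast
  define Z where "Z = Z_const \<Phi>"
  define C where "C = \<bar>truncated_function.C_ent \<Phi> M \<epsilon> m C\<^sub>H C\<^sub>d Z\<bar>"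
  have "Ent (mu \<Phi>) (\<lambda>x. (f x)\<^sup>2)
      \<le> ereal ((18 + 8 * C) * Var (mu \<Phi>) f) + ereal (C + 1) * H_energy \<Phi> B 1 4 f"
    if f: "locally_abs_continuous f" "\<forall>x. f x \<ge> 0" "(\<integral>x. (f x)\<^sup>2 \<partial>mu \<Phi>) = 1" for f
  proof -
    obtain g where g: "g \<in> borel_measurable borel"
      "AE x in lborel. (f has_real_derivative g x) (at x)"
      using continuous_borel_derivative[OF locally_abs_continuous_imp_continuous[OF f(1)]
          locally_abs_continuous_AE_differentiable[OF f(1)]] by blast
    interpret truncated_function \<Phi> M \<epsilon> m C\<^sub>H C\<^sub>d h f g
      by unfold_locales (use m' h C\<^sub>d f g in auto)
    show ?thesis
      by (rule modified_log_sobolev_truncated[OF Z_def f(3) h(4)]) (auto simp: C_def)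
  qed
  moreover have "C \<ge> 0" by (simp add: C_def)
  ultimately show ?thesis
    using h(1)
    by (intro exI[of _ "18 + 8 * C"] exI[of _ "C + 1"] exI[of _ B] exI[of _ 1] exI[of _ 4]) simp
qed

end
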